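(* Let $k$ be a field of characteristic zero and let $A$ be a commutative $k$-algebra (not assumed to be noetherian). Suppose that there is an injective $k$-algebra homomorphism $\iota: k[t_1,\ldots,t_s]\hookrightarrow A$ from the polynomial ring in $s$ variables, for some $s\geq 1$. Then $d\iota(t_1)\wedge d\iota(t_2)\wedge\cdots\wedge d\iota(t_s)$ is a nonzero element of $\wedge^s_A\Omega_{A/k}$.
   Context: All rings are commutative and unital. $\Omega_{A/k}$ is the module of Kähler differentials of $A$ over $k$, $d:A\to\Omega_{A/k}$ is the universal $k$-derivation, and $\wedge^s_A$ denotes the $s$-th exterior power over $A$. *)

theory Defs
  imports "HOL-Algebra.Algebra"
begin

section \<open>Modules by generators and relations\<close>

text \<open>
  The record \<^typ>\<open>('a, 'b) module\<close> extends the ring record, so module constructions have to fill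
  the fields \<open>mult\<close> and \<open>one\<close>; the locale \<open>module\<close> never looks at them and they
  are left \<open>undefined\<close> below.
\<close>

definition free_module :: "('r, 'm) ring_scheme \<Rightarrow> 'x set \<Rightarrow> ('r, 'x \<Rightarrow> 'r) module" where
  "free_module R B =
    \<lparr>carrier = {f. (\<forall>x\<in>B. f x \<in> carrier R) \<and> (\<forall>x. x \<notin> B \<longrightarrow> f x = \<zero>\<^bsub>R\<^esub>) \<and> finite {x. f x \<noteq> \<zero>\<^bsub>R\<^esub>}},
     monoid.mult = undefined, one = undefined,
     ring.zero = (\<lambda>_. \<zero>\<^bsub>R\<^esub>), ring.add = (\<lambda>f g x. f x \<oplus>\<^bsub>R\<^esub> g x),
     smult = (\<lambda>r f x. r \<otimes>\<^bsub>R\<^esub> f x)\<rparr>"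

definition free_gen :: "('r, 'm) ring_scheme \<Rightarrow> 'x \<Rightarrow> 'x \<Rightarrow> 'r" where
  "free_gen R x = (\<lambda>y. if y = x then \<one>\<^bsub>R\<^esub> else \<zero>\<^bsub>R\<^esub>)"

definition submodule_span ::
    "('r, 'm) ring_scheme \<Rightarrow> ('r, 'b, 'n) module_scheme \<Rightarrow> 'b set \<Rightarrow> 'b set" where
  "submodule_span R M S = \<Inter>{N. submodule N R M \<and> S \<subseteq> N}"

definition quotient_module ::
    "('r, 'b, 'n) module_scheme \<Rightarrow> 'b set \<Rightarrow> ('r, 'b set) module" where
  "quotient_module M N =
    \<lparr>carrier = a_rcosets\<^bsub>M\<^esub> N,
     monoid.mult = undefined, one = undefined,
     ring.zero = N, ring.add = set_add M,
     smult = (\<lambda>r C. \<Union>x\<in>C. N +>\<^bsub>M\<^esub> (r \<odot>\<^bsub>M\<^esub> x))\<rparr>"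

section \<open>Kaehler differentials\<close>

definition kaehler_relations ::
    "('k, 'm) ring_scheme \<Rightarrow> ('k, 'a, 'n) module_scheme \<Rightarrow> ('a \<Rightarrow> 'a) set" where
  "kaehler_relations k A =
    (let F = free_module A (carrier A); \<delta> = free_gen A in
       {\<delta> (a \<oplus>\<^bsub>A\<^esub> b) \<ominus>\<^bsub>F\<^esub> (\<delta> a \<oplus>\<^bsub>F\<^esub> \<delta> b) | a b. a \<in> carrier A \<and> b \<in> carrier A}
     \<union> {\<delta> (a \<otimes>\<^bsub>A\<^esub> b) \<ominus>\<^bsub>F\<^esub> (a \<odot>\<^bsub>F\<^esub> \<delta> b \<oplus>\<^bsub>F\<^esub> b \<odot>\<^bsub>F\<^esub> \<delta> a) | a b. a \<in> carrier A \<and> b \<in> carrier A}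
     \<union> {\<delta> (c \<odot>\<^bsub>A\<^esub> \<one>\<^bsub>A\<^esub>) | c. c \<in> carrier k})"

definition kaehler_submodule ::
    "('k, 'm) ring_scheme \<Rightarrow> ('k, 'a, 'n) module_scheme \<Rightarrow> ('a \<Rightarrow> 'a) set" where
  "kaehler_submodule k A = submodule_span A (free_module A (carrier A)) (kaehler_relations k A)"

definition kaehler ::
    "('k, 'm) ring_scheme \<Rightarrow> ('k, 'a, 'n) module_scheme \<Rightarrow> ('a, ('a \<Rightarrow> 'a) set) module" where
  "kaehler k A = quotient_module (free_module A (carrier A)) (kaehler_submodule k A)"

definition kaehler_d ::
    "('k, 'm) ring_scheme \<Rightarrow> ('k, 'a, 'n) module_scheme \<Rightarrow> 'a \<Rightarrow> ('a \<Rightarrow> 'a) set" where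
  "kaehler_d k A a = kaehler_submodule k A +>\<^bsub>free_module A (carrier A)\<^esub> free_gen A a"

section \<open>Exterior powers\<close>

text \<open>
  The \<open>s\<close>-th exterior power is the \<open>s\<close>-fold tensor power modulo the tensors with two equal
  factors. The tensor power is itself a quotient of the free module on \<open>s\<close>-tuples, represented as
  lists of length \<open>s\<close>, and both quotients are taken at once.
\<close>

definition tuples :: "nat \<Rightarrow> ('r, 'b, 'n) module_scheme \<Rightarrow> 'b list set" where
  "tuples s M = {xs. length xs = s \<and> set xs \<subseteq> carrier M}"

definition exterior_relations ::
    "('r, 'm) ring_scheme \<Rightarrow> ('r, 'b, 'n) module_scheme \<Rightarrow> nat \<Rightarrow> ('b list \<Rightarrow> 'r) set" where
  "exterior_relations R M s =
    (let F = free_module R (tuples s M); e = free_gen R in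
       {e (xs[i := x \<oplus>\<^bsub>M\<^esub> y]) \<ominus>\<^bsub>F\<^esub> (e (xs[i := x]) \<oplus>\<^bsub>F\<^esub> e (xs[i := y])) | xs i x y.
          xs \<in> tuples s M \<and> i < s \<and> x \<in> carrier M \<and> y \<in> carrier M}
     \<union> {e (xs[i := r \<odot>\<^bsub>M\<^esub> x]) \<ominus>\<^bsub>F\<^esub> (r \<odot>\<^bsub>F\<^esub> e (xs[i := x])) | xs i r x.
          xs \<in> tuples s M \<and> i < s \<and> r \<in> carrier R \<and> x \<in> carrier M}
     \<union> {e xs | xs. xs \<in> tuples s M \<and> (\<exists>i j. i < j \<and> j < s \<and> xs ! i = xs ! j)})"

definition exterior_submodule ::
    "('r, 'm) ring_scheme \<Rightarrow> ('r, 'b, 'n) module_scheme \<Rightarrow> nat \<Rightarrow> ('b list \<Rightarrow> 'r) set" where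
  "exterior_submodule R M s = submodule_span R (free_module R (tuples s M)) (exterior_relations R M s)"

definition exterior_power ::
    "('r, 'm) ring_scheme \<Rightarrow> ('r, 'b, 'n) module_scheme \<Rightarrow> nat \<Rightarrow> ('r, ('b list \<Rightarrow> 'r) set) module" where
  "exterior_power R M s = quotient_module (free_module R (tuples s M)) (exterior_submodule R M s)"

definition wedge ::
    "('r, 'm) ring_scheme \<Rightarrow> ('r, 'b, 'n) module_scheme \<Rightarrow> 'b list \<Rightarrow> ('b list \<Rightarrow> 'r) set" where
  "wedge R M xs =
     exterior_submodule R M (length xs) +>\<^bsub>free_module R (tuples (length xs) M)\<^esub> free_gen R xs"

section \<open>Polynomial algebras and algebra homomorphisms\<close>

text \<open>
  The library provides the set of polynomials in variables indexed by \<open>I\<close> (coefficient functions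
  on monomials, a monomial being a multiset of indices), but only multiplication by a single
  variable. Multiplication of two polynomials is convolution.
\<close>

definition mpoly_algebra :: "('k, 'm) ring_scheme \<Rightarrow> 'i set \<Rightarrow> ('k, 'i multiset \<Rightarrow> 'k) module" where
  "mpoly_algebra k I =
    \<lparr>carrier = ring.indexed_pset k I (carrier k),
     monoid.mult = (\<lambda>P Q m. \<Oplus>\<^bsub>k\<^esub> u \<in> {u. u \<subseteq># m}. P u \<otimes>\<^bsub>k\<^esub> Q (m - u)),
     one = ring.indexed_const k \<one>\<^bsub>k\<^esub>,
     ring.zero = ring.indexed_const k \<zero>\<^bsub>k\<^esub>, ring.add = ring.indexed_padd k,
     smult = (\<lambda>c P m. c \<otimes>\<^bsub>k\<^esub> P m)\<rparr>"

definition algebra_hom ::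
    "('k, 'm) ring_scheme \<Rightarrow> ('k, 'a, 'n) module_scheme \<Rightarrow> ('k, 'b, 'o) module_scheme \<Rightarrow> ('a \<Rightarrow> 'b) set" where
  "algebra_hom k A B =
    {h \<in> ring_hom A B. \<forall>c\<in>carrier k. \<forall>a\<in>carrier A. h (c \<odot>\<^bsub>A\<^esub> a) = c \<odot>\<^bsub>B\<^esub> h a}"

section \<open>Well-definedness\<close>

lemma module_free_module:
  assumes "cring R" shows "module R (free_module R B)"
proof -
  interpret cring R by fact
  show ?thesis
  proof (rule moduleI)
    show "cring R" by fact
    show "abelian_group (free_module R B)"
    proof (rule abelian_groupI)
      fix f g assume "f \<in> carrier (free_module R B)" "g \<in> carrier (free_module R B)"
      moreover from this have "{x. f x \<oplus>\<^bsub>R\<^esub> g x \<noteq> \<zero>\<^bsub>R\<^esub>} \<subseteq> {x. f x \<noteq> \<zero>\<^bsub>R\<^esub>} \<union> {x. g x \<noteq> \<zero>\<^bsub>R\<^esub>}"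
        by auto
      ultimately show "f \<oplus>\<^bsub>free_module R B\<^esub> g \<in> carrier (free_module R B)"
        by (auto simp: free_module_def intro: finite_subset)
    next
      fix f g assume *: "f \<in> carrier (free_module R B)" "g \<in> carrier (free_module R B)"
      have "f x \<in> carrier R" "g x \<in> carrier R" for x
        using * by (cases "x \<in> B"; force simp: free_module_def)+
      then show "f \<oplus>\<^bsub>free_module R B\<^esub> g = g \<oplus>\<^bsub>free_module R B\<^esub> f"
        by (simp add: free_module_def a_comm)
      fix h assume "h \<in> carrier (free_module R B)"
      then have "h x \<in> carrier R" for x by (cases "x \<in> B"; force simp: free_module_def)
      then show "f \<oplus>\<^bsub>free_module R B\<^esub> g \<oplus>\<^bsub>free_module R B\<^esub> h = f \<oplus>\<^bsub>free_module R B\<^esub> (g \<oplus>\<^bsub>free_module R B\<^esub> h)"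
        using \<open>\<And>x. f x \<in> carrier R\<close> \<open>\<And>x. g x \<in> carrier R\<close>
        by (simp add: free_module_def a_assoc)
    next
      fix f assume *: "f \<in> carrier (free_module R B)"
      have c: "f x \<in> carrier R" for x
        using * by (cases "x \<in> B"; force simp: free_module_def)+
      then show "\<zero>\<^bsub>free_module R B\<^esub> \<oplus>\<^bsub>free_module R B\<^esub> f = f"
        by (simp add: free_module_def)
      have "{x. \<ominus>\<^bsub>R\<^esub> f x \<noteq> \<zero>\<^bsub>R\<^esub>} = {x. f x \<noteq> \<zero>\<^bsub>R\<^esub>}"
        using c by (metis local.minus_minus local.minus_zero)
      then show "\<exists>g\<in>carrier (free_module R B). g \<oplus>\<^bsub>free_module R B\<^esub> f = \<zero>\<^bsub>free_module R B\<^esub>"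
        using * c by (intro bexI[of _ "\<lambda>x. \<ominus>\<^bsub>R\<^esub> f x"]) (auto simp: free_module_def l_neg)
    qed (simp add: free_module_def)
  next
    fix a f assume "a \<in> carrier R" "f \<in> carrier (free_module R B)"
    moreover from this have "{x. a \<otimes>\<^bsub>R\<^esub> f x \<noteq> \<zero>\<^bsub>R\<^esub>} \<subseteq> {x. f x \<noteq> \<zero>\<^bsub>R\<^esub>}" by auto
    ultimately show "a \<odot>\<^bsub>free_module R B\<^esub> f \<in> carrier (free_module R B)"
      by (auto simp: free_module_def intro: finite_subset)
  next
    fix a b f assume "a \<in> carrier R" "b \<in> carrier R" and *: "f \<in> carrier (free_module R B)"
    moreover have "f x \<in> carrier R" for x
      using * by (cases "x \<in> B"; force simp: free_module_def)+
    ultimately show "(a \<oplus>\<^bsub>R\<^esub> b) \<odot>\<^bsub>free_module R B\<^esub> f = a \<odot>\<^bsub>free_module R B\<^esub> f \<oplus>\<^bsub>free_module R B\<^esub> b \<odot>\<^bsub>free_module R B\<^esub> f"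
      "(a \<otimes>\<^bsub>R\<^esub> b) \<odot>\<^bsub>free_module R B\<^esub> f = a \<odot>\<^bsub>free_module R B\<^esub> (b \<odot>\<^bsub>free_module R B\<^esub> f)"
      by (auto simp: free_module_def l_distr m_assoc)
  next
    fix a f g assume "a \<in> carrier R" and *: "f \<in> carrier (free_module R B)" "g \<in> carrier (free_module R B)"
    moreover have "f x \<in> carrier R" "g x \<in> carrier R" for x
      using * by (cases "x \<in> B"; force simp: free_module_def)+
    ultimately show "a \<odot>\<^bsub>free_module R B\<^esub> (f \<oplus>\<^bsub>free_module R B\<^esub> g) = a \<odot>\<^bsub>free_module R B\<^esub> f \<oplus>\<^bsub>free_module R B\<^esub> a \<odot>\<^bsub>free_module R B\<^esub> g"
      by (auto simp: free_module_def r_distr)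
  next
    fix f assume *: "f \<in> carrier (free_module R B)"
    have "f x \<in> carrier R" for x
      using * by (cases "x \<in> B"; force simp: free_module_def)+
    then show "\<one>\<^bsub>R\<^esub> \<odot>\<^bsub>free_module R B\<^esub> f = f" by (simp add: free_module_def)
  qed
qed

lemma submodule_span_submodule:
  assumes "module R M" "S \<subseteq> carrier M"
  shows "submodule (submodule_span R M S) R M"
proof -
  interpret module R M by fact
  have c: "submodule (carrier M) R M" by (rule carrier_is_submodule)
  show ?thesis unfolding submodule_span_def
  proof (rule submoduleI)
    show "\<Inter>{N. submodule N R M \<and> S \<subseteq> N} \<subseteq> carrier M" using c assms by blast
    show "\<zero>\<^bsub>M\<^esub> \<in> \<Inter>{N. submodule N R M \<and> S \<subseteq> N}"
      by (auto dest!: submodule.axioms(1) subgroup.one_closed)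
  qed (auto dest: submoduleE)
qed

lemma quotient_smult:
  assumes "module R M" "submodule N R M" "r \<in> carrier R" "x \<in> carrier M"
  shows "r \<odot>\<^bsub>quotient_module M N\<^esub> (N +>\<^bsub>M\<^esub> x) = N +>\<^bsub>M\<^esub> (r \<odot>\<^bsub>M\<^esub> x)"
proof -
  interpret module R M by fact
  interpret N: abelian_subgroup N M
    by (intro abelian_subgroupI3 additive_subgroup.intro submodule.axioms(1)[OF assms(2)]) unfold_locales
  have eq: "N +>\<^bsub>M\<^esub> (r \<odot>\<^bsub>M\<^esub> y) = N +>\<^bsub>M\<^esub> (r \<odot>\<^bsub>M\<^esub> x)" if y: "y \<in> N +>\<^bsub>M\<^esub> x" for y
  proof -
    obtain n where n: "n \<in> N" "y = n \<oplus>\<^bsub>M\<^esub> x" using y by (auto simp: a_r_coset_def')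
    have nc: "n \<in> carrier M" using n N.a_subset by auto
    have "r \<odot>\<^bsub>M\<^esub> y = r \<odot>\<^bsub>M\<^esub> n \<oplus>\<^bsub>M\<^esub> r \<odot>\<^bsub>M\<^esub> x" using n nc assms by (simp add: smult_r_distr)
    moreover have "r \<odot>\<^bsub>M\<^esub> n \<in> N" using assms n submoduleE(4) by blast
    ultimately have "r \<odot>\<^bsub>M\<^esub> y \<in> N +>\<^bsub>M\<^esub> (r \<odot>\<^bsub>M\<^esub> x)" by (auto simp: a_r_coset_def')
    then show ?thesis using a_repr_independence[OF _ _ submodule.axioms(1)[OF assms(2)]] assms by force
  qed
  have "N +>\<^bsub>M\<^esub> x \<noteq> {}" using N.a_rcos_self assms by blast
  then have "(\<Union>y\<in>N +>\<^bsub>M\<^esub> x. N +>\<^bsub>M\<^esub> (r \<odot>\<^bsub>M\<^esub> y)) = N +>\<^bsub>M\<^esub> (r \<odot>\<^bsub>M\<^esub> x)"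
    using eq by (metis (no_types, lifting) SUP_cong UN_constant)
  then show ?thesis by (simp add: quotient_module_def)
qed

lemma module_quotient_module:
  assumes "module R M" "submodule N R M"
  shows "module R (quotient_module M N)"
proof -
  interpret module R M by fact
  interpret N: abelian_subgroup N M
    by (intro abelian_subgroupI3 additive_subgroup.intro submodule.axioms(1)[OF assms(2)]) unfold_locales
  let ?Q = "quotient_module M N"
  have rep: "\<exists>x\<in>carrier M. X' = N +>\<^bsub>M\<^esub> x" if "X' \<in> carrier ?Q" for X'
    using that by (auto simp: quotient_module_def A_RCOSETS_def')
  have inQ: "N +>\<^bsub>M\<^esub> x \<in> carrier ?Q" if "x \<in> carrier M" for x
    using that by (auto simp: quotient_module_def A_RCOSETS_def')
  have add: "(N +>\<^bsub>M\<^esub> x) \<oplus>\<^bsub>?Q\<^esub> (N +>\<^bsub>M\<^esub> y) = N +>\<^bsub>M\<^esub> (x \<oplus>\<^bsub>M\<^esub> y)" if "x \<in> carrier M" "y \<in> carrier M" for x y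
    using that N.a_rcos_sum by (simp add: quotient_module_def)
  have zero: "\<zero>\<^bsub>?Q\<^esub> = N +>\<^bsub>M\<^esub> \<zero>\<^bsub>M\<^esub>"
    by (simp add: quotient_module_def M.a_coset_add_zero N.a_subset)
  note sm = quotient_smult[OF assms]
  show ?thesis
  proof (rule moduleI)
    show "cring R" by unfold_locales
    show "abelian_group ?Q"
    proof (rule abelian_groupI)
      fix X' assume "X' \<in> carrier ?Q"
      then obtain x where x: "x \<in> carrier M" "X' = N +>\<^bsub>M\<^esub> x" using rep by blast
      show "\<exists>y\<in>carrier ?Q. y \<oplus>\<^bsub>?Q\<^esub> X' = \<zero>\<^bsub>?Q\<^esub>"
        using x by (intro bexI[of _ "N +>\<^bsub>M\<^esub> (\<ominus>\<^bsub>M\<^esub> x)"]) (auto simp: add zero inQ M.l_neg)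
    qed (auto dest!: rep simp: add inQ zero M.a_assoc M.a_comm M.a_lcomm)
  qed (auto dest!: rep simp: add inQ sm smult_l_distr smult_r_distr smult_assoc1)
qed

lemma free_gen_closed [intro]:
  assumes "cring R" "b \<in> B" shows "free_gen R b \<in> carrier (free_module R B)"
proof -
  interpret cring R by fact
  have "finite {x. (if x = b then \<one>\<^bsub>R\<^esub> else \<zero>\<^bsub>R\<^esub>) \<noteq> \<zero>\<^bsub>R\<^esub>}"
    by (rule finite_subset[of _ "{b}"]) auto
  then show ?thesis using assms(2) by (auto simp: free_module_def free_gen_def)
qed

lemma submodule_kaehler_submodule:
  assumes "algebra k A"
  shows "submodule (kaehler_submodule k A) A (free_module A (carrier A))"
proof -
  interpret algebra k A by fact
  have A: "cring A" by (rule M_cring)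
  interpret F: module A "free_module A (carrier A)" by (rule module_free_module[OF A])
  show ?thesis unfolding kaehler_submodule_def
  proof (rule submodule_span_submodule[OF F.module_axioms])
    show "kaehler_relations k A \<subseteq> carrier (free_module A (carrier A))"
      unfolding kaehler_relations_def Let_def
      by (auto intro!: F.minus_closed F.add.m_closed F.smult_closed free_gen_closed[OF A])
  qed
qed

lemma kaehler_module:
  assumes "algebra k A" shows "module A (kaehler k A)"
  unfolding kaehler_def
  by (rule module_quotient_module[OF module_free_module[OF algebra.M_cring[OF assms]]
        submodule_kaehler_submodule[OF assms]])

lemma submodule_exterior_submodule:
  assumes "module R M"
  shows "submodule (exterior_submodule R M s) R (free_module R (tuples s M))"
proof -
  interpret module R M by fact
  have R: "cring R" by unfold_locales
  interpret F: module R "free_module R (tuples s M)" by (rule module_free_module[OF R])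
  have u: "xs[i := x] \<in> tuples s M" if "xs \<in> tuples s M" "x \<in> carrier M" for xs i x
    using that set_update_subset_insert[of xs i x] by (auto simp: tuples_def)
  show ?thesis unfolding exterior_submodule_def
  proof (rule submodule_span_submodule[OF F.module_axioms])
    show "exterior_relations R M s \<subseteq> carrier (free_module R (tuples s M))"
      unfolding exterior_relations_def Let_def
      by (auto intro!: F.minus_closed F.add.m_closed F.smult_closed free_gen_closed[OF R] u)
  qed
qed

lemma exterior_power_module:
  assumes "module R M" shows "module R (exterior_power R M s)"
  unfolding exterior_power_def
  by (rule module_quotient_module[OF module_free_module[OF module.axioms(1)[OF assms]]
        submodule_exterior_submodule[OF assms]])

lemma wedge_closed:
  assumes "module R M" "set xs \<subseteq> carrier M"
  shows "wedge R M xs \<in> carrier (exterior_power R M (length xs))"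
proof -
  have "free_gen R xs \<in> carrier (free_module R (tuples (length xs) M))"
    using assms by (intro free_gen_closed) (auto simp: tuples_def module_def)
  then show ?thesis
    by (auto simp: wedge_def exterior_power_def quotient_module_def A_RCOSETS_def')
qed

lemma kaehler_d_closed:
  assumes "algebra k A" "a \<in> carrier A" shows "kaehler_d k A a \<in> carrier (kaehler k A)"
  using free_gen_closed[OF algebra.M_cring[OF assms(1)] assms(2)]
  by (auto simp: kaehler_d_def kaehler_def quotient_module_def A_RCOSETS_def')

lemma finite_submultisets: "finite {u. u \<subseteq># m}"
proof (induction m)
  case (add x m)
  have "{u. u \<subseteq># add_mset x m} \<subseteq> {u. u \<subseteq># m} \<union> add_mset x ` {u. u \<subseteq># m}"
  proof
    fix u assume "u \<in> {u. u \<subseteq># add_mset x m}"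
    then have u: "u \<subseteq># add_mset x m" by simp
    show "u \<in> {u. u \<subseteq># m} \<union> add_mset x ` {u. u \<subseteq># m}"
    proof (cases "x \<in># u")
      case True
      then obtain v where v: "u = add_mset x v" by (blast dest: multi_member_split)
      have "v \<subseteq># m" using u unfolding v by (rule mset_subset_eq_add_mset_cancel[THEN iffD1])
      with v show ?thesis by blast
    next
      case False
      have "count u y \<le> count m y" for y
        using mset_subset_eq_count[OF u, of y] False by (cases "y = x") (auto simp: not_in_iff)
      then show ?thesis by (simp add: subseteq_mset_def)
    qed
  qed
  then show ?case using add by (auto elim: finite_subset)
qed simp

text \<open>Convolution extends the library's multiplication by a variable.\<close>

lemma (in cring) mpoly_mult_var:
  assumes P: "carrier_coeff P"
  shows "P \<otimes>\<^bsub>mpoly_algebra R I\<^esub> indexed_var i = indexed_pmult P i"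
proof
  fix m
  have P: "P x \<in> carrier R" for x using P by (simp add: carrier_coeff_def)
  have iv: "\<X>\<^bsub>i\<^esub> n = (if n = {#i#} then \<one> else \<zero>)" for n
  proof (cases "i \<in># n")
    case True
    then obtain n' where "n = add_mset i n'" by (blast dest: multi_member_split)
    then show ?thesis by (simp add: indexed_var_def indexed_pmult_def indexed_const_def)
  qed (auto simp: indexed_var_def indexed_pmult_def)
  show "(P \<otimes>\<^bsub>mpoly_algebra R I\<^esub> indexed_var i) m = indexed_pmult P i m"
  proof (cases "i \<in># m")
    case True
    have eq: "m - u = {#i#} \<longleftrightarrow> m - {#i#} = u" if "u \<subseteq># m" for u
    proof -
      have m: "m = m - u + u" "m = m - {#i#} + {#i#}" using that True by simp_all
      show ?thesis
      proof
        assume "m - u = {#i#}"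
        with m(1) have "m = {#i#} + u" by simp
        then show "m - {#i#} = u" by simp
      next
        assume "m - {#i#} = u"
        with m(2) have "m = u + {#i#}" by simp
        then show "m - u = {#i#}" by simp
      qed
    qed
    have "(\<Oplus>u\<in>{u. u \<subseteq># m}. P u \<otimes> \<X>\<^bsub>i\<^esub> (m - u)) = (\<Oplus>u\<in>{u. u \<subseteq># m}. if m - {#i#} = u then P u else \<zero>)"
      by (rule finsum_cong') (auto simp: iv P eq)
    also have "\<dots> = P (m - {#i#})"
      by (subst finsum_singleton) (auto simp: P finite_submultisets)
    finally show ?thesis using True by (simp add: mpoly_algebra_def indexed_pmult_def)
  next
    case False
    have "m - u \<noteq> {#i#}" for u using False by (metis in_diffD multi_member_last)
    then have "(\<Oplus>u\<in>{u. u \<subseteq># m}. P u \<otimes> \<X>\<^bsub>i\<^esub> (m - u)) = (\<Oplus>u\<in>{u. u \<subseteq># m}. \<zero>)"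
      by (intro finsum_cong') (auto simp: iv P)
    then show ?thesis using False by (simp add: mpoly_algebra_def indexed_pmult_def)
  qed
qed
end

theory Submission
  imports Defs "HOL-Library.Multiset_Order" "HOL-Combinatorics.Permutations"
begin

text \<open>
  The nonzero elements of the image of \<open>k[t\<^sub>1,\<dots>,t\<^sub>s]\<close> form a multiplicative set that avoids \<open>0\<close>,
  so some prime ideal \<open>P\<close> of \<open>A\<close> is disjoint from it and \<open>k[t\<^sub>1,\<dots>,t\<^sub>s]\<close> embeds into the field
  \<open>K = Frac (A/P)\<close>. A derivation defined on a subring of a field of characteristic zero extends to
  the whole field, so every \<open>\<partial>/\<partial>t\<^sub>i\<close> extends to \<open>K\<close>; composed with \<open>A \<rightarrow> K\<close> it yields a linear form
  \<open>\<beta>\<^sub>i\<close> on the differentials with \<open>\<beta>\<^sub>i (dt\<^sub>j) = \<delta>\<^sub>i\<^sub>j\<close>. The alternating form \<open>det (\<beta>\<^sub>i (x\<^sub>j))\<close> factors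
  through the exterior power and takes the value \<open>1\<close> on \<open>dt\<^sub>1 \<and> \<dots> \<and> dt\<^sub>s\<close>.
\<close>

section \<open>Polynomials in several variables\<close>

text \<open>The partial derivatives need not extend to \<open>A\<close> itself: for
  \<open>A = k[u]\<close> and \<open>t = u^2\<close> the derivation
  \<open>\<partial>/\<partial>t\<close> would have to send \<open>u\<close> to
  \<open>1/(2u)\<close>. This is why only derivations with values in a field are sought. The field
  must keep the polynomials intact: modulo an arbitrary prime ideal of \<open>A\<close> the images
  of the \<open>t\<^sub>i\<close> may become algebraically dependent, and
  \<open>\<partial>/\<partial>t\<^sub>i\<close> then makes no sense on the image. Characteristic
  zero cannot be dropped: over a field of characteristic \<open>p\<close>, with
  \<open>A = k[u]\<close> and \<open>t = u^p\<close>, already \<open>dt = 0\<close>. It enters where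
  a polynomial of minimal degree that vanishes at a given element must have a derivative that does
  not. As \<open>K\<close> may be far from finitely generated, derivations are extended by one
  element at a time and Zorn's lemma does the rest. They are only required to be additive and to
  satisfy the Leibniz rule; linearity over \<open>k\<close> is regained at the end, because the
  extensions still vanish on the image of \<open>k\<close>.\<close>

lemma (in cring) add_self_eq: "a \<in> carrier R \<Longrightarrow> a \<oplus> a = a \<Longrightarrow> a = \<zero>"
  by (simp add: add.l_cancel_one')

context cring
begin

lemma mpoly_closed:
  "P \<in> carrier (mpoly_algebra R I) \<Longrightarrow> P m \<in> carrier R"
  using indexed_pset_in_carrier[of "carrier R" P I] by (simp add: mpoly_algebra_def carrier_coeff_def)

text \<open>Convolution is handled through this induction on its right factor: the rules for a
  constant, a sum and a multiple of a variable serve as its recursion equations, and closure and the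
  Leibniz rule follow from them.\<close>

lemma mpoly_induct [consumes 1, case_names const add var]:
  assumes "P \<in> carrier (mpoly_algebra R I)"
    and "\<And>c. c \<in> carrier R \<Longrightarrow> \<Phi> (indexed_const c)"
    and "\<And>P Q. \<lbrakk>P \<in> carrier (mpoly_algebra R I); \<Phi> P; Q \<in> carrier (mpoly_algebra R I); \<Phi> Q\<rbrakk>
           \<Longrightarrow> \<Phi> (indexed_padd P Q)"
    and "\<And>P i. \<lbrakk>P \<in> carrier (mpoly_algebra R I); \<Phi> P; i \<in> I\<rbrakk> \<Longrightarrow> \<Phi> (indexed_pmult P i)"
  shows "\<Phi> P"
proof -
  have "P \<in> indexed_pset I (carrier R)" using assms(1) by (simp add: mpoly_algebra_def)
  then show ?thesis by induction (auto intro: assms(2-) simp: mpoly_algebra_def)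
qed

lemma mpoly_intros:
  "c \<in> carrier R \<Longrightarrow> indexed_const c \<in> carrier (mpoly_algebra R I)"
  "P \<in> carrier (mpoly_algebra R I) \<Longrightarrow> Q \<in> carrier (mpoly_algebra R I)
    \<Longrightarrow> indexed_padd P Q \<in> carrier (mpoly_algebra R I)"
  "P \<in> carrier (mpoly_algebra R I) \<Longrightarrow> i \<in> I \<Longrightarrow> indexed_pmult P i \<in> carrier (mpoly_algebra R I)"
  by (simp_all add: mpoly_algebra_def indexed_pset.intros)

lemma indexed_var_closed: "i \<in> I \<Longrightarrow> indexed_var i \<in> carrier (mpoly_algebra R I)"
  by (simp add: indexed_var_def mpoly_intros)

text \<open>This is what gives a nonzero polynomial a leading monomial.\<close>

lemma mpoly_finite_support:
  assumes "P \<in> carrier (mpoly_algebra R I)" shows "finite {m. P m \<noteq> \<zero>}"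
  using assms
proof (induction rule: mpoly_induct)
  case (const c)
  show ?case by (rule finite_subset[of _ "{{#}}"]) (auto simp: indexed_const_def)
next
  case (add P Q)
  have "{m. indexed_padd P Q m \<noteq> \<zero>} \<subseteq> {m. P m \<noteq> \<zero>} \<union> {m. Q m \<noteq> \<zero>}"
    by (auto simp: indexed_padd_def)
  then show ?case using add by (auto elim: finite_subset)
next
  case (var P i)
  have "{m. indexed_pmult P i m \<noteq> \<zero>} \<subseteq> add_mset i ` {m. P m \<noteq> \<zero>}"
    by (auto simp: indexed_pmult_def image_iff split: if_splits)
      (metis insert_DiffM)
  then show ?case using var by (auto elim: finite_subset)
qed

lemma mpoly_mult_const:
  assumes "\<And>m. P m \<in> carrier R" "c \<in> carrier R"
  shows "P \<otimes>\<^bsub>mpoly_algebra R I\<^esub> indexed_const c = (\<lambda>m. P m \<otimes> c)"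
proof
  fix m :: "'c multiset"
  have eq: "m - u = {#} \<longleftrightarrow> m = u" if "u \<subseteq># m" for u
    using that by (metis Diff_eq_empty_iff_mset subset_mset.antisym subset_mset.order_refl)
  have "(\<Oplus>u\<in>{u. u \<subseteq># m}. P u \<otimes> indexed_const c (m - u)) =
      (\<Oplus>u\<in>{u. u \<subseteq># m}. if m = u then P u \<otimes> c else \<zero>)"
    by (rule finsum_cong') (auto simp: indexed_const_def assms eq)
  also have "\<dots> = P m \<otimes> c"
    by (subst finsum_singleton) (auto simp: assms finite_submultisets)
  finally show "(P \<otimes>\<^bsub>mpoly_algebra R I\<^esub> indexed_const c) m = P m \<otimes> c"
    by (simp add: mpoly_algebra_def)
qed

lemma mpoly_mult_padd:
  assumes "\<And>m. P m \<in> carrier R" "\<And>m. Q m \<in> carrier R" "\<And>m. Q' m \<in> carrier R"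
  shows "P \<otimes>\<^bsub>mpoly_algebra R I\<^esub> indexed_padd Q Q' =
    indexed_padd (P \<otimes>\<^bsub>mpoly_algebra R I\<^esub> Q) (P \<otimes>\<^bsub>mpoly_algebra R I\<^esub> Q')"
proof
  fix m
  have "(\<Oplus>u\<in>{u. u \<subseteq># m}. P u \<otimes> indexed_padd Q Q' (m - u)) =
      (\<Oplus>u\<in>{u. u \<subseteq># m}. P u \<otimes> Q (m - u) \<oplus> P u \<otimes> Q' (m - u))"
    by (rule finsum_cong') (auto simp: indexed_padd_def assms r_distr)
  also have "\<dots> = (\<Oplus>u\<in>{u. u \<subseteq># m}. P u \<otimes> Q (m - u)) \<oplus> (\<Oplus>u\<in>{u. u \<subseteq># m}. P u \<otimes> Q' (m - u))"
    by (rule finsum_addf) (auto simp: assms)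
  finally show "(P \<otimes>\<^bsub>mpoly_algebra R I\<^esub> indexed_padd Q Q') m =
    indexed_padd (P \<otimes>\<^bsub>mpoly_algebra R I\<^esub> Q) (P \<otimes>\<^bsub>mpoly_algebra R I\<^esub> Q') m"
    by (simp add: mpoly_algebra_def indexed_padd_def)
qed

text \<open>Only those \<open>u\<close> contribute for which \<open>i\<close> occurs in
  \<open>m - u\<close>; for \<open>m = add_mset i n\<close> they are exactly the submultisets of
  \<open>n\<close>, and what remains is the convolution at \<open>n\<close>.\<close>

lemma mpoly_mult_pmult:
  assumes "\<And>m. P m \<in> carrier R" "\<And>m. Q m \<in> carrier R"
  shows "P \<otimes>\<^bsub>mpoly_algebra R I\<^esub> indexed_pmult Q i = indexed_pmult (P \<otimes>\<^bsub>mpoly_algebra R I\<^esub> Q) i"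
proof
  fix m
  show "(P \<otimes>\<^bsub>mpoly_algebra R I\<^esub> indexed_pmult Q i) m =
    indexed_pmult (P \<otimes>\<^bsub>mpoly_algebra R I\<^esub> Q) i m"
  proof (cases "i \<in># m")
    case True
    then obtain n where m: "m = add_mset i n" by (blast dest: multi_member_split)
    have c: "indexed_pmult Q i u \<in> carrier R" for u by (simp add: indexed_pmult_def assms)
    have sub: "{u. u \<subseteq># n} \<subseteq> {u. u \<subseteq># m}"
      by (auto simp: m intro: subset_mset.order_trans)
    have out: "indexed_pmult Q i (m - u) = \<zero>" if "u \<subseteq># m" "\<not> u \<subseteq># n" for u
    proof -
      have "i \<notin># m - u"
      proof
        assume "i \<in># m - u"
        then obtain w where "m - u = add_mset i w" by (blast dest: multi_member_split)
        with that(1) have "m = add_mset i (w + u)" by (metis subset_mset.diff_add union_mset_add_mset_left)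
        with that(2) m show False by auto
      qed
      then show ?thesis by (simp add: indexed_pmult_def)
    qed
    have inn: "indexed_pmult Q i (m - u) = Q (n - u)" if "u \<subseteq># n" for u
    proof -
      have "m - u = add_mset i (n - u)"
        using that subset_mset.diff_add_assoc2[of u n "{#i#}"] by (simp add: m)
      then show ?thesis by (simp add: indexed_pmult_def)
    qed
    have "(\<Oplus>u\<in>{u. u \<subseteq># m}. P u \<otimes> indexed_pmult Q i (m - u)) =
      (\<Oplus>u\<in>{u. u \<subseteq># n}. P u \<otimes> Q (n - u))"
      by (rule add.finprod_mono_neutral_cong_right[OF finite_submultisets sub])
        (auto simp: out inn assms c)
    then show ?thesis by (simp add: mpoly_algebra_def indexed_pmult_def m)
  next
    case False
    have "(\<Oplus>u\<in>{u. u \<subseteq># m}. P u \<otimes> indexed_pmult Q i (m - u)) = (\<Oplus>u\<in>{u. u \<subseteq># m}. \<zero>)"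
      using False by (intro finsum_cong') (auto simp: assms indexed_pmult_def dest: in_diffD)
    then show ?thesis using False by (simp add: mpoly_algebra_def indexed_pmult_def)
  qed
qed

lemma mpoly_smult_closed:
  fixes I :: "'i set"
  assumes "P \<in> carrier (mpoly_algebra R I)" "c \<in> carrier R"
  shows "(\<lambda>m. P m \<otimes> c) \<in> carrier (mpoly_algebra R I)"
  using assms(1)
proof (induction rule: mpoly_induct)
  case (const d)
  have "(\<lambda>m :: 'i multiset. indexed_const d m \<otimes> c) = indexed_const (d \<otimes> c)"
    using assms by (auto simp: indexed_const_def)
  then show ?case using const assms by (simp only:) (simp add: mpoly_intros)
next
  case (add P Q)
  have "(\<lambda>m. indexed_padd P Q m \<otimes> c) = indexed_padd (\<lambda>m. P m \<otimes> c) (\<lambda>m. Q m \<otimes> c)"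
    using assms mpoly_closed[OF add(1)] mpoly_closed[OF add(2)]
    by (auto simp: indexed_padd_def l_distr)
  then show ?case using add by (simp only:) (simp add: mpoly_intros)
next
  case (var P i)
  have "(\<lambda>m. indexed_pmult P i m \<otimes> c) = indexed_pmult (\<lambda>m. P m \<otimes> c) i"
    using assms by (auto simp: indexed_pmult_def)
  then show ?case using var by (simp only:) (simp add: mpoly_intros)
qed

lemma mpoly_mult_closed:
  assumes P: "P \<in> carrier (mpoly_algebra R I)" and Q: "Q \<in> carrier (mpoly_algebra R I)"
  shows "P \<otimes>\<^bsub>mpoly_algebra R I\<^esub> Q \<in> carrier (mpoly_algebra R I)"
  using Q
proof (induction rule: mpoly_induct)
  case (const c)
  then show ?case using P by (simp add: mpoly_mult_const mpoly_closed[OF P] mpoly_smult_closed)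
next
  case (add Q Q')
  then show ?case by (simp add: mpoly_mult_padd mpoly_closed[OF P] mpoly_closed mpoly_intros)
next
  case (var Q i)
  then show ?case by (simp add: mpoly_mult_pmult mpoly_closed[OF P] mpoly_closed mpoly_intros)
qed

section \<open>Formal partial derivatives and their Leibniz rule\<close>

text \<open>The coefficient of the monomial \<open>m\<close> in
  \<open>\<partial>P/\<partial>t\<^sub>i\<close> comes from the monomial \<open>add_mset i m\<close>
  of \<open>P\<close>, in which \<open>t\<^sub>i\<close> has exponent
  \<open>Suc (count m i)\<close>.\<close>

definition mpoly_pderiv :: "'i \<Rightarrow> ('i multiset \<Rightarrow> 'a) \<Rightarrow> 'i multiset \<Rightarrow> 'a" where
  "mpoly_pderiv i P m = [Suc (count m i)] \<cdot> P (add_mset i m)"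

lemma mpoly_pderiv_const: "mpoly_pderiv i (indexed_const c) = indexed_const \<zero>"
  by (auto simp: mpoly_pderiv_def indexed_const_def)

lemma mpoly_pderiv_padd:
  assumes "\<And>m. P m \<in> carrier R" "\<And>m. Q m \<in> carrier R"
  shows "mpoly_pderiv i (indexed_padd P Q) = indexed_padd (mpoly_pderiv i P) (mpoly_pderiv i Q)"
  by (rule ext) (simp add: mpoly_pderiv_def indexed_padd_def add.nat_pow_distrib assms del: add.nat_pow_Suc)

text \<open>For \<open>i = j\<close> the coefficient at \<open>m\<close> consists of
  \<open>Suc (count m j)\<close> copies of \<open>P m\<close>. One of them is the extra summand
  \<open>P\<close>; the other \<open>count m j\<close> come from the derivative of \<open>P\<close>,
  and there are none if \<open>j\<close> does not occur in \<open>m\<close>.\<close>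

lemma mpoly_pderiv_pmult:
  assumes "\<And>m. P m \<in> carrier R"
  shows "mpoly_pderiv i (indexed_pmult P j) =
    indexed_padd (indexed_pmult (mpoly_pderiv i P) j) (if i = j then P else indexed_const \<zero>)"
proof
  fix m
  show "mpoly_pderiv i (indexed_pmult P j) m =
    indexed_padd (indexed_pmult (mpoly_pderiv i P) j) (if i = j then P else indexed_const \<zero>) m"
  proof (cases "i = j")
    case True
    show ?thesis
    proof (cases "j \<in># m")
      case False
      then show ?thesis using True assms
        by (simp add: mpoly_pderiv_def indexed_padd_def indexed_pmult_def count_eq_zero_iff[THEN iffD2])
    next
      case inm: True
      then obtain n where m: "m = add_mset j n" by (blast dest: multi_member_split)
      show ?thesis using True assms
        by (simp add: mpoly_pderiv_def indexed_padd_def indexed_pmult_def m)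
    qed
  next
    case False
    show ?thesis
    proof (cases "j \<in># m")
      case inm: True
      then obtain n where m: "m = add_mset j n" by (blast dest: multi_member_split)
      show ?thesis using False assms
        by (simp add: mpoly_pderiv_def indexed_padd_def indexed_pmult_def indexed_const_def m add_mset_commute)
    qed (use False assms in \<open>simp add: mpoly_pderiv_def indexed_padd_def indexed_pmult_def indexed_const_def\<close>)
  qed
qed

lemma mpoly_pderiv_closed:
  assumes "P \<in> carrier (mpoly_algebra R I)"
  shows "mpoly_pderiv i P \<in> carrier (mpoly_algebra R I)"
  using assms
  by (induction rule: mpoly_induct)
    (auto simp: mpoly_pderiv_const mpoly_pderiv_padd mpoly_pderiv_pmult mpoly_closed mpoly_intros)

text \<open>By induction on \<open>Q\<close> the general product rule reduces to the one for a
  single variable, since convolution commutes with sums and multiples of variables in its right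
  factor.\<close>

lemma mpoly_pderiv_mult:
  assumes P: "P \<in> carrier (mpoly_algebra R I)" and Q: "Q \<in> carrier (mpoly_algebra R I)"
  shows "mpoly_pderiv i (P \<otimes>\<^bsub>mpoly_algebra R I\<^esub> Q) =
    indexed_padd (P \<otimes>\<^bsub>mpoly_algebra R I\<^esub> mpoly_pderiv i Q) (mpoly_pderiv i P \<otimes>\<^bsub>mpoly_algebra R I\<^esub> Q)"
  using Q
proof (induction rule: mpoly_induct)
  case (const c)
  note [simp] = mpoly_closed[OF P] mpoly_closed[OF mpoly_pderiv_closed[OF P]]
  show ?case
    using const mpoly_closed[OF mpoly_pderiv_closed[OF P, of i]]
    by (simp add: mpoly_pderiv_const mpoly_mult_const)
      (auto simp: mpoly_pderiv_def indexed_padd_def add_pow_ldistr simp del: add.nat_pow_Suc)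
next
  case (add Q Q')
  note c = mpoly_closed[OF P] mpoly_closed[OF mpoly_pderiv_closed[OF P]]
    mpoly_closed[OF add(1)] mpoly_closed[OF mpoly_pderiv_closed[OF add(1)]]
    mpoly_closed[OF add(2)] mpoly_closed[OF mpoly_pderiv_closed[OF add(2)]]
    mpoly_closed[OF mpoly_mult_closed[OF P add(1)]] mpoly_closed[OF mpoly_mult_closed[OF P add(2)]]
    mpoly_closed[OF mpoly_mult_closed[OF P mpoly_pderiv_closed[OF add(1)]]]
    mpoly_closed[OF mpoly_mult_closed[OF P mpoly_pderiv_closed[OF add(2)]]]
    mpoly_closed[OF mpoly_mult_closed[OF mpoly_pderiv_closed[OF P] add(1)]]
    mpoly_closed[OF mpoly_mult_closed[OF mpoly_pderiv_closed[OF P] add(2)]]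
  show ?case
    by (simp add: mpoly_mult_padd mpoly_pderiv_padd c add.IH)
      (auto simp: indexed_padd_def c a_ac)
next
  case (var Q j)
  note c = mpoly_closed[OF P] mpoly_closed[OF mpoly_pderiv_closed[OF P]]
    mpoly_closed[OF var(1)] mpoly_closed[OF mpoly_pderiv_closed[OF var(1)]]
    mpoly_closed[OF mpoly_mult_closed[OF P var(1)]]
    mpoly_closed[OF mpoly_mult_closed[OF P mpoly_pderiv_closed[OF var(1)]]]
    mpoly_closed[OF mpoly_mult_closed[OF mpoly_pderiv_closed[OF P] var(1)]]
  have z: "\<And>m. indexed_const \<zero> m \<in> carrier R" "\<And>m. indexed_const \<zero> m = \<zero>"
    by (simp_all add: indexed_const_def)
  have pc: "\<And>m. indexed_pmult (mpoly_pderiv i Q) j m \<in> carrier R"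
    by (simp add: indexed_pmult_def c)
  show ?case
    by (simp add: mpoly_mult_padd mpoly_mult_pmult mpoly_pderiv_pmult mpoly_mult_const z pc c var.IH)
      (auto simp: indexed_padd_def indexed_pmult_def z c a_ac)
qed

lemma mpoly_pderiv_var:
  "mpoly_pderiv i (indexed_var j) = indexed_const (if i = j then \<one> else \<zero>)"
  by (subst indexed_var_def, subst mpoly_pderiv_pmult)
    (simp_all add: mpoly_pderiv_const, simp_all add: indexed_padd_def indexed_const_def)

end

text \<open>Leading monomials with respect to the multiset order multiply.\<close>

lemma (in domain) mpoly_mult_nonzero:
  fixes P Q :: "'i::linorder multiset \<Rightarrow> 'a"
  assumes P: "P \<in> carrier (mpoly_algebra R I)" and Q: "Q \<in> carrier (mpoly_algebra R I)"
    and nz: "P \<noteq> indexed_const \<zero>" "Q \<noteq> indexed_const \<zero>"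
  shows "P \<otimes>\<^bsub>mpoly_algebra R I\<^esub> Q \<noteq> indexed_const \<zero>"
proof -
  define a where "a = Max {m. P m \<noteq> \<zero>}"
  define b where "b = Max {m. Q m \<noteq> \<zero>}"
  have fin: "finite {m. P m \<noteq> \<zero>}" "finite {m. Q m \<noteq> \<zero>}" using P Q mpoly_finite_support by auto
  have ne: "{m. P m \<noteq> \<zero>} \<noteq> {}" "{m. Q m \<noteq> \<zero>} \<noteq> {}"
    using nz by (auto simp: indexed_const_def fun_eq_iff)
  have a: "P a \<noteq> \<zero>" "\<And>m. P m \<noteq> \<zero> \<Longrightarrow> m \<le> a"
    using Max_in[OF fin(1) ne(1)] Max_ge[OF fin(1)] by (auto simp: a_def)
  have b: "Q b \<noteq> \<zero>" "\<And>m. Q m \<noteq> \<zero> \<Longrightarrow> m \<le> b"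
    using Max_in[OF fin(2) ne(2)] Max_ge[OF fin(2)] by (auto simp: b_def)
  note [simp] = mpoly_closed[OF P] mpoly_closed[OF Q]
  \<comment> \<open>Any other \<open>u\<close> with both factors nonzero would satisfy
    \<open>u < a\<close> and \<open>a + b - u \<le> b\<close>, and adding these gives
    \<open>a + b < a + b\<close>. So the coefficient at \<open>a + b\<close> is a single
    product.\<close>
  have "P u \<otimes> Q (a + b - u) = (if a = u then P a \<otimes> Q b else \<zero>)" if u: "u \<subseteq># a + b" for u
  proof (cases "a = u")
    case False
    have "P u = \<zero> \<or> Q (a + b - u) = \<zero>"
    proof (rule ccontr)
      assume "\<not> ?thesis"
      with a b False have "u < a" "a + b - u \<le> b" by (auto simp: less_le)
      then have "u + (a + b - u) < a + b" by (rule add_less_le_mono)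
      with u show False by simp
    qed
    then show ?thesis using False by auto
  qed auto
  then have "(\<Oplus>u\<in>{u. u \<subseteq># a + b}. P u \<otimes> Q (a + b - u)) =
      (\<Oplus>u\<in>{u. u \<subseteq># a + b}. if a = u then P a \<otimes> Q b else \<zero>)"
    by (intro finsum_cong') auto
  also have "\<dots> = P a \<otimes> Q b"
    by (subst finsum_singleton) (auto simp: finite_submultisets)
  finally have "(P \<otimes>\<^bsub>mpoly_algebra R I\<^esub> Q) (a + b) \<noteq> \<zero>"
    using a b by (simp add: mpoly_algebra_def integral_iff)
  then show ?thesis by (auto simp: indexed_const_def)
qed

section \<open>Extension of derivations\<close>

text \<open>\<open>K\<close> is regarded as an \<open>A\<close>-module through
  \<open>\<phi>\<close>, without forming this module.\<close>

definition derivation_along ::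
    "('a, 'm) ring_scheme \<Rightarrow> ('c, 'n) ring_scheme \<Rightarrow> ('a \<Rightarrow> 'c) \<Rightarrow> ('a \<Rightarrow> 'c) \<Rightarrow> bool" where
  "derivation_along A K \<phi> D \<longleftrightarrow> D \<in> carrier A \<rightarrow> carrier K \<and>
     (\<forall>a\<in>carrier A. \<forall>b\<in>carrier A. D (a \<oplus>\<^bsub>A\<^esub> b) = D a \<oplus>\<^bsub>K\<^esub> D b \<and>
        D (a \<otimes>\<^bsub>A\<^esub> b) = \<phi> a \<otimes>\<^bsub>K\<^esub> D b \<oplus>\<^bsub>K\<^esub> \<phi> b \<otimes>\<^bsub>K\<^esub> D a)"

lemma derivation_alongD:
  assumes "derivation_along A K \<phi> D" "a \<in> carrier A"
  shows "D a \<in> carrier K"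
    and "b \<in> carrier A \<Longrightarrow> D (a \<oplus>\<^bsub>A\<^esub> b) = D a \<oplus>\<^bsub>K\<^esub> D b"
    and "b \<in> carrier A \<Longrightarrow> D (a \<otimes>\<^bsub>A\<^esub> b) = \<phi> a \<otimes>\<^bsub>K\<^esub> D b \<oplus>\<^bsub>K\<^esub> \<phi> b \<otimes>\<^bsub>K\<^esub> D a"
  using assms by (auto simp: derivation_along_def)

lemma derivation_along_comp:
  assumes D: "derivation_along B K id D" and \<phi>: "\<phi> \<in> ring_hom A B"
  shows "derivation_along A K \<phi> (D \<circ> \<phi>)"
  using ring_hom_closed[OF \<phi>] ring_hom_add[OF \<phi>] ring_hom_mult[OF \<phi>] D
  by (auto simp: derivation_along_def)

text \<open>The pair \<open>(a, b)\<close> stands for \<open>a + \<epsilon>b\<close> with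
  \<open>\<epsilon>\<^sup>2 = 0\<close>; the second component of a product is the Leibniz
  rule.\<close>

definition dual_ring :: "('c, 'm) ring_scheme \<Rightarrow> ('c \<times> 'c) ring" where
  "dual_ring K =
    \<lparr>carrier = carrier K \<times> carrier K,
     monoid.mult = (\<lambda>p q. (fst p \<otimes>\<^bsub>K\<^esub> fst q, fst p \<otimes>\<^bsub>K\<^esub> snd q \<oplus>\<^bsub>K\<^esub> snd p \<otimes>\<^bsub>K\<^esub> fst q)),
     one = (\<one>\<^bsub>K\<^esub>, \<zero>\<^bsub>K\<^esub>), ring.zero = (\<zero>\<^bsub>K\<^esub>, \<zero>\<^bsub>K\<^esub>),
     ring.add = (\<lambda>p q. (fst p \<oplus>\<^bsub>K\<^esub> fst q, snd p \<oplus>\<^bsub>K\<^esub> snd q))\<rparr>"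

lemma dual_ring_simps [simp]:
  "carrier (dual_ring K) = carrier K \<times> carrier K"
  "\<one>\<^bsub>dual_ring K\<^esub> = (\<one>\<^bsub>K\<^esub>, \<zero>\<^bsub>K\<^esub>)"
  "\<zero>\<^bsub>dual_ring K\<^esub> = (\<zero>\<^bsub>K\<^esub>, \<zero>\<^bsub>K\<^esub>)"
  "p \<otimes>\<^bsub>dual_ring K\<^esub> q = (fst p \<otimes>\<^bsub>K\<^esub> fst q, fst p \<otimes>\<^bsub>K\<^esub> snd q \<oplus>\<^bsub>K\<^esub> snd p \<otimes>\<^bsub>K\<^esub> fst q)"
  "p \<oplus>\<^bsub>dual_ring K\<^esub> q = (fst p \<oplus>\<^bsub>K\<^esub> fst q, snd p \<oplus>\<^bsub>K\<^esub> snd q)"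
  by (simp_all add: dual_ring_def)

lemma (in cring) cring_dual_ring: "cring (dual_ring R)"
proof (rule cringI)
  show "abelian_group (dual_ring R)"
  proof (rule abelian_groupI)
    fix p assume "p \<in> carrier (dual_ring R)"
    then show "\<exists>q\<in>carrier (dual_ring R). q \<oplus>\<^bsub>dual_ring R\<^esub> p = \<zero>\<^bsub>dual_ring R\<^esub>"
      by (intro bexI[of _ "(\<ominus> fst p, \<ominus> snd p)"]) (auto simp: l_neg)
  qed (auto simp: a_ac)
  show "comm_monoid (dual_ring R)"
    by (rule comm_monoidI) (auto simp: m_ac a_ac l_distr r_distr)
qed (auto simp: m_ac a_ac l_distr r_distr)

lemma (in cring) dual_ring_a_inv:
  assumes "p \<in> carrier (dual_ring R)"
  shows "\<ominus>\<^bsub>dual_ring R\<^esub> p = (\<ominus> fst p, \<ominus> snd p)"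
proof -
  interpret E: cring "dual_ring R" by (rule cring_dual_ring)
  show ?thesis by (rule E.minus_equality) (use assms in \<open>auto simp: l_neg\<close>)
qed

section \<open>First-order Taylor expansion of univariate polynomials\<close>

lemma (in cring) nilpotent_pow:
  assumes "z \<in> carrier R" "e \<in> carrier R" "e \<otimes> e = \<zero>"
  shows "(z \<oplus> e) [^] (Suc i) = z [^] (Suc i) \<oplus> [Suc i] \<cdot> (z [^] i \<otimes> e)"
proof (induction i)
  case 0
  then show ?case using assms by simp
next
  case (Suc i)
  let ?w = "[Suc i] \<cdot> (z [^] i \<otimes> e)"
  have w: "?w = ([Suc i] \<cdot> (z [^] i)) \<otimes> e" using assms by (simp add: add_pow_ldistr del: add.nat_pow_Suc)
  have we: "?w \<otimes> e = \<zero>" using assms by (simp add: w m_assoc del: add.nat_pow_Suc)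
  have wz: "?w \<otimes> z = [Suc i] \<cdot> (z [^] Suc i \<otimes> e)"
    using assms by (simp add: add_pow_ldistr add_pow_rdistr m_ac del: add.nat_pow_Suc)
  have "(z \<oplus> e) [^] (Suc (Suc i)) = (z [^] (Suc i) \<oplus> ?w) \<otimes> (z \<oplus> e)"
    using Suc by (simp del: add.nat_pow_Suc)
  also have "\<dots> = z [^] (Suc (Suc i)) \<oplus> (z [^] Suc i \<otimes> e \<oplus> ?w \<otimes> z) \<oplus> ?w \<otimes> e"
    using assms by (simp add: l_distr r_distr a_ac del: add.nat_pow_Suc)
  also have "\<dots> = z [^] (Suc (Suc i)) \<oplus> [Suc (Suc i)] \<cdot> (z [^] Suc i \<otimes> e)"
    unfolding we wz using assms add.nat_pow_Suc2[of "z [^] Suc i \<otimes> e" "Suc i"]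
    by (simp del: add.nat_pow_Suc nat_pow_Suc)
  finally show ?case .
qed

text \<open>The formal derivative. In degree zero the truncated subtraction leaves the single index
  \<open>0\<close>, whose coefficient is the vanishing one of degree one.\<close>

definition (in UP) up_deriv :: "(nat \<Rightarrow> 'a) \<Rightarrow> nat \<Rightarrow> 'a" where
  "up_deriv p = (\<Oplus>\<^bsub>P\<^esub>i \<in> {..deg R p - 1}. up_ring.monom P ([Suc i] \<cdot> up_ring.coeff P p (Suc i)) i)"

lemma (in UP_cring) up_deriv_closed: "p \<in> carrier P \<Longrightarrow> up_deriv p \<in> carrier P"
  by (auto simp: up_deriv_def intro!: P.finsum_closed)

lemma (in UP_cring) coeff_up_deriv:
  assumes "p \<in> carrier P"
  shows "up_ring.coeff P (up_deriv p) j = (if j \<le> deg R p - 1 then [Suc j] \<cdot> up_ring.coeff P p (Suc j) else \<zero>)"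
proof -
  have "up_ring.coeff P (up_deriv p) j =
      (\<Oplus>i\<in>{..deg R p - 1}. if i = j then [Suc i] \<cdot> up_ring.coeff P p (Suc i) else \<zero>)"
    unfolding up_deriv_def using assms
    by (subst coeff_finsum) (auto simp del: R.add.nat_pow_Suc intro!: R.finsum_cong')
  also have "\<dots> = (if j \<le> deg R p - 1 then [Suc j] \<cdot> up_ring.coeff P p (Suc j) else \<zero>)"
  proof (cases "j \<le> deg R p - 1")
    case True
    then have "(\<Oplus>i\<in>{..deg R p - 1}. if j = i then [Suc i] \<cdot> up_ring.coeff P p (Suc i) else \<zero>) =
        [Suc j] \<cdot> up_ring.coeff P p (Suc j)"
      using assms by (intro R.finsum_singleton) auto
    with True show ?thesis by (simp add: eq_commute del: R.add.nat_pow_Suc)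
  next
    case False
    then have "(\<Oplus>i\<in>{..deg R p - 1}. if i = j then [Suc i] \<cdot> up_ring.coeff P p (Suc i) else \<zero>) =
        (\<Oplus>i\<in>{..deg R p - 1}. \<zero>)"
      by (intro R.finsum_cong') auto
    with False show ?thesis by simp
  qed
  finally show ?thesis .
qed

text \<open>Taylor's formula stops after the linear term because \<open>e\<close> has square zero.
  It will be applied in the dual numbers with \<open>e = \<epsilon>y\<close>, where it shows how the
  value of a polynomial depends on the choice of \<open>y\<close>.\<close>

lemma (in UP_pre_univ_prop) eval_nilpotent_shift:
  assumes p: "p \<in> carrier P" and deg: "deg R p > 0"
    and z: "z \<in> carrier S" and e: "e \<in> carrier S" "e \<otimes>\<^bsub>S\<^esub> e = \<zero>\<^bsub>S\<^esub>"
  shows "UnivPoly.eval R S h (z \<oplus>\<^bsub>S\<^esub> e) p = UnivPoly.eval R S h z p \<oplus>\<^bsub>S\<^esub> UnivPoly.eval R S h z (up_deriv p) \<otimes>\<^bsub>S\<^esub> e"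
proof -
  obtain m where m: "deg R p = Suc m" using deg by (cases "deg R p") auto
  interpret E: ring_hom_cring P S "UnivPoly.eval R S h z"
    by (rule ring_hom_cringI[OF UP_cring S.cring_axioms eval_ring_hom[OF z]])
  let ?c = "\<lambda>i. h (up_ring.coeff P p i)"
  have c: "?c i \<in> carrier S" for i using p by simp
  have nat: "h ([n] \<cdot>\<^bsub>R\<^esub> a) = [n] \<cdot>\<^bsub>S\<^esub> h a" if "a \<in> carrier R" for n :: nat and a
    using that by (induction n) auto
  have "UnivPoly.eval R S h z (up_deriv p) = (\<Oplus>\<^bsub>S\<^esub>i\<in>{..m}. UnivPoly.eval R S h z (up_ring.monom P ([Suc i] \<cdot>\<^bsub>R\<^esub> up_ring.coeff P p (Suc i)) i))"
    unfolding up_deriv_def m using p by (subst E.hom_finsum) (auto simp: o_def)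
  also have "\<dots> = (\<Oplus>\<^bsub>S\<^esub>i\<in>{..m}. ([Suc i] \<cdot>\<^bsub>S\<^esub> ?c (Suc i)) \<otimes>\<^bsub>S\<^esub> z [^]\<^bsub>S\<^esub> i)"
    using p z by (intro S.finsum_cong') (auto simp: eval_monom nat c simp del: R.add.nat_pow_Suc S.add.nat_pow_Suc)
  finally have d: "UnivPoly.eval R S h z (up_deriv p) \<otimes>\<^bsub>S\<^esub> e =
      (\<Oplus>\<^bsub>S\<^esub>i\<in>{..m}. ([Suc i] \<cdot>\<^bsub>S\<^esub> ?c (Suc i)) \<otimes>\<^bsub>S\<^esub> z [^]\<^bsub>S\<^esub> i \<otimes>\<^bsub>S\<^esub> e)"
    using z e c by (simp add: S.finsum_ldistr Pi_def del: S.add.nat_pow_Suc)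
  \<comment> \<open>The constant coefficient is split off, so that every remaining power has an
    exponent \<open>Suc i\<close>, as \<open>nilpotent_pow\<close> expects.\<close>
  have "UnivPoly.eval R S h (z \<oplus>\<^bsub>S\<^esub> e) p = (\<Oplus>\<^bsub>S\<^esub>i\<in>{..m}. ?c (Suc i) \<otimes>\<^bsub>S\<^esub> (z \<oplus>\<^bsub>S\<^esub> e) [^]\<^bsub>S\<^esub> (Suc i)) \<oplus>\<^bsub>S\<^esub> ?c 0"
    using z e c p by (simp add: eval_on_carrier m S.finsum_Suc2 Pi_def del: S.nat_pow_Suc S.finsum_Suc)
  also have "\<dots> = (\<Oplus>\<^bsub>S\<^esub>i\<in>{..m}. ?c (Suc i) \<otimes>\<^bsub>S\<^esub> z [^]\<^bsub>S\<^esub> (Suc i) \<oplus>\<^bsub>S\<^esub>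
      ([Suc i] \<cdot>\<^bsub>S\<^esub> ?c (Suc i)) \<otimes>\<^bsub>S\<^esub> z [^]\<^bsub>S\<^esub> i \<otimes>\<^bsub>S\<^esub> e) \<oplus>\<^bsub>S\<^esub> ?c 0"
    using z e c
    by (intro arg_cong2[of _ _ _ _ "add S"] S.finsum_cong' refl; (subst S.nilpotent_pow)?)
      (auto simp: S.r_distr S.add_pow_rdistr S.add_pow_ldistr S.m_assoc
        simp del: S.nat_pow_Suc S.add.nat_pow_Suc)
  also have "\<dots> = (\<Oplus>\<^bsub>S\<^esub>i\<in>{..m}. ?c (Suc i) \<otimes>\<^bsub>S\<^esub> z [^]\<^bsub>S\<^esub> (Suc i)) \<oplus>\<^bsub>S\<^esub>
      UnivPoly.eval R S h z (up_deriv p) \<otimes>\<^bsub>S\<^esub> e \<oplus>\<^bsub>S\<^esub> ?c 0"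
    unfolding d using z e c by (subst S.finsum_addf) (auto simp del: S.nat_pow_Suc S.add.nat_pow_Suc)
  also have "\<dots> = UnivPoly.eval R S h z p \<oplus>\<^bsub>S\<^esub> UnivPoly.eval R S h z (up_deriv p) \<otimes>\<^bsub>S\<^esub> e"
    using z e c p up_deriv_closed[OF p]
    by (simp add: eval_on_carrier[OF p] m S.finsum_Suc2 Pi_def S.a_ac del: S.nat_pow_Suc S.finsum_Suc)
  finally show ?thesis .
qed

text \<open>
  A derivation \<open>D\<close> from a subring of \<open>K\<close> to \<open>K\<close> is the same as a subring of the dual numbers
  \<open>K[\<epsilon>]\<close>, namely its graph \<open>{b + \<epsilon> D b}\<close>, that meets \<open>\<epsilon>K\<close> only in \<open>0\<close>.
\<close>

definition graph_like :: "('c, 'm) ring_scheme \<Rightarrow> ('c \<times> 'c) set \<Rightarrow> bool" where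
  "graph_like K G \<longleftrightarrow> subring G (dual_ring K) \<and> (\<forall>b. (\<zero>\<^bsub>K\<^esub>, b) \<in> G \<longrightarrow> b = \<zero>\<^bsub>K\<^esub>)"

text \<open>
  The new value \<open>y\<close> at \<open>x\<close> is arbitrary if \<open>x\<close> is transcendental over the domain of the graph.
  Otherwise let \<open>p\<close> be a polynomial of minimal degree over \<open>G\<close> whose value at \<open>x\<close> lies in \<open>\<epsilon>K\<close>;
  \<open>y\<close> is chosen to make \<open>x + \<epsilon>y\<close> a root of \<open>p\<close>, which is possible as \<open>p'\<close> does not vanish at \<open>x\<close> in
  characteristic zero. Pseudo-division by \<open>p\<close> then controls all other polynomials.
\<close>

lemma (in field) graph_like_extend:
  assumes char_zero: "\<And>n :: nat. n > 0 \<Longrightarrow> [n] \<cdot> \<one> \<noteq> \<zero>"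
    and G: "graph_like R G" and x: "x \<in> carrier R"
  shows "\<exists>y\<in>carrier R. \<exists>G'. graph_like R G' \<and> insert (x, y) G \<subseteq> G'"
proof -
  define E where "E = dual_ring R"
  interpret E: cring E unfolding E_def by (rule cring_dual_ring)
  have subG: "subring G E" and G0: "\<And>b. (\<zero>, b) \<in> G \<Longrightarrow> b = \<zero>"
    using G by (auto simp: graph_like_def E_def)
  define B where "B = E\<lparr>carrier := G\<rparr>"
  have Gc: "G \<subseteq> carrier R \<times> carrier R" using subringE(1)[OF subG] by (simp add: E_def)
  interpret B: cring B
    unfolding B_def using E.subcring_iff[of G] E.subcringI'[OF subG] subringE(1)[OF subG] by simp
  have id: "id \<in> ring_hom B E"
    using Gc by (auto intro!: ring_hom_memI simp: B_def E_def)
  define P where "P = UP B"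
  interpret U: UP_pre_univ_prop B E id P
    by (intro_locales) (auto simp: P_def UP_def ring_hom_cring_axioms_def id)
  have Bs: "carrier B = G" "\<zero>\<^bsub>B\<^esub> = (\<zero>, \<zero>)" "\<And>p q. p \<oplus>\<^bsub>B\<^esub> q = (fst p \<oplus> fst q, snd p \<oplus> snd q)"
    by (simp_all add: B_def E_def)
  \<comment> \<open>A coefficient from \<open>G\<close> carries its own derivative along. Hence the
    first component of \<open>ev y p\<close> is the value of \<open>p\<close> at \<open>x\<close>,
    and the second is the derivative that the choice of \<open>y\<close> forces on this
    value.\<close>
  define ev where "ev y = UnivPoly.eval B E id (x, y)" for y
  have xy: "(x, y) \<in> carrier E" if "y \<in> carrier R" for y using that x by (simp add: E_def)
  have ev: "ring_hom_cring P E (ev y)" if "y \<in> carrier R" for y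
    unfolding ev_def
    by (rule ring_hom_cringI[OF U.UP_cring E.cring_axioms U.eval_ring_hom[OF xy[OF that]]])
  have shift: "ev y p = ev \<zero> p \<oplus>\<^bsub>E\<^esub> ev \<zero> (U.up_deriv p) \<otimes>\<^bsub>E\<^esub> (\<zero>, y)"
    if "p \<in> carrier P" "deg B p > 0" "y \<in> carrier R" for p y
    using U.eval_nilpotent_shift[OF that(1,2) xy[of \<zero>], of "(\<zero>, y)"] that x
    by (simp add: ev_def E_def)
  have const: "p = up_ring.monom P (up_ring.coeff P p 0) 0 \<and> ev y p = up_ring.coeff P p 0"
    if "p \<in> carrier P" "deg B p = 0" "y \<in> carrier R" for p y
  proof -
    have "p = up_ring.monom P (up_ring.coeff P p 0) 0" using that by (simp add: U.deg_zero_impl_monom)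
    then show ?thesis using that U.eval_const[OF xy, of y "up_ring.coeff P p 0"]
      by (metis U.coeff_closed ev_def id_apply)
  qed
  have evc: "fst (ev y p) \<in> carrier R" "snd (ev y p) \<in> carrier R" if "p \<in> carrier P" "y \<in> carrier R" for p y
    using ring_hom_closed[OF ring_hom_cring.homh[OF ev[OF that(2)]] that(1)] by (auto simp: E_def)
  have fst_ev: "fst (ev y p) = fst (ev \<zero> p)" if "p \<in> carrier P" "y \<in> carrier R" for p y
  proof (cases "deg B p = 0")
    case True
    then show ?thesis using const[OF that(1) True] that(2) by simp
  next
    case False
    then show ?thesis using shift[OF that(1) _ that(2)] evc[OF that(1), of \<zero>]
        evc[OF U.up_deriv_closed[OF that(1)], of \<zero>] that(2)
      by (simp add: E_def)
  qed
  \<comment> \<open>Any \<open>y\<close> whatsoever yields a subring that contains \<open>G\<close>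
    and \<open>x + \<epsilon>y\<close>; what the choice of \<open>y\<close> has to secure is that
    the subring meets \<open>\<epsilon>K\<close> only in \<open>0\<close>.\<close>
  have image: "subring (ev y ` carrier P) E \<and> insert (x, y) G \<subseteq> ev y ` carrier P" if "y \<in> carrier R" for y
  proof
    interpret H: ring_hom_cring P E "ev y" by (rule ev[OF that])
    show "subring (ev y ` carrier P) E"
    proof (rule E.subringI)
      show "ev y ` carrier P \<subseteq> carrier E" by auto
      show "\<one>\<^bsub>E\<^esub> \<in> ev y ` carrier P" using H.hom_one U.P.one_closed by (metis image_eqI)
    next
      fix a assume "a \<in> ev y ` carrier P"
      then show "\<ominus>\<^bsub>E\<^esub> a \<in> ev y ` carrier P"
        by (auto simp flip: H.hom_a_inv)
    next
      fix a b assume "a \<in> ev y ` carrier P" "b \<in> ev y ` carrier P"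
      then obtain p q where "p \<in> carrier P" "q \<in> carrier P" "a = ev y p" "b = ev y q" by auto
      then show "a \<otimes>\<^bsub>E\<^esub> b \<in> ev y ` carrier P" "a \<oplus>\<^bsub>E\<^esub> b \<in> ev y ` carrier P"
        by (metis H.hom_mult U.P.m_closed image_eqI, metis H.hom_add U.P.a_closed image_eqI)
    qed
    have "(x, y) = ev y (up_ring.monom P \<one>\<^bsub>B\<^esub> 1)"
      using U.eval_monom1[OF xy[OF that]] by (simp add: ev_def)
    moreover have "g = ev y (up_ring.monom P g 0)" if "g \<in> G" for g
      using U.eval_const[OF xy[OF \<open>y \<in> carrier R\<close>], of g] that by (simp add: ev_def Bs)
    ultimately show "insert (x, y) G \<subseteq> ev y ` carrier P"
      using Bs(1) U.monom_closed by (metis (no_types, lifting) B.one_closed image_eqI insertE subsetI)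
  qed
  show ?thesis
  proof (cases "\<exists>p\<in>carrier P. p \<noteq> \<zero>\<^bsub>P\<^esub> \<and> fst (ev \<zero> p) = \<zero>")
    \<comment> \<open>The transcendental case: only the zero polynomial has its value at
      \<open>x\<close> in \<open>\<epsilon>K\<close>, so \<open>y = 0\<close> serves as well as any
      other value.\<close>
    case False
    interpret H: ring_hom_cring P E "ev \<zero>" by (rule ev) simp
    have "b = \<zero>" if mem: "(\<zero>, b) \<in> ev \<zero> ` carrier P" for b
    proof -
      obtain q where q: "q \<in> carrier P" "(\<zero>, b) = ev \<zero> q" using mem by (rule imageE)
      with False have "q = \<zero>\<^bsub>P\<^esub>" by (metis fst_conv)
      with q(2) H.hom_zero show ?thesis by (simp add: E_def)
    qed
    then have "graph_like R (ev \<zero> ` carrier P)"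
      using image[of \<zero>] by (auto simp: graph_like_def E_def)
    then show ?thesis using image[of \<zero>] by blast
  next
    case True
    then obtain p0 where p0: "p0 \<in> carrier P \<and> p0 \<noteq> \<zero>\<^bsub>P\<^esub> \<and> fst (ev \<zero> p0) = \<zero>" by blast
    obtain p where p': "p \<in> carrier P \<and> p \<noteq> \<zero>\<^bsub>P\<^esub> \<and> fst (ev \<zero> p) = \<zero>"
      and min': "\<forall>q. q \<in> carrier P \<and> q \<noteq> \<zero>\<^bsub>P\<^esub> \<and> fst (ev \<zero> q) = \<zero> \<longrightarrow> deg B p \<le> deg B q"
      using ex_has_least_nat[of "\<lambda>p. p \<in> carrier P \<and> p \<noteq> \<zero>\<^bsub>P\<^esub> \<and> fst (ev \<zero> p) = \<zero>", OF p0, of "deg B"]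
      by (elim exE conjE) (rule that; (intro conjI)?; assumption)
    have p: "p \<in> carrier P" "p \<noteq> \<zero>\<^bsub>P\<^esub>" "fst (ev \<zero> p) = \<zero>" using p' by simp_all
    have min: "deg B p \<le> deg B q" if "q \<in> carrier P" "q \<noteq> \<zero>\<^bsub>P\<^esub>" "fst (ev \<zero> q) = \<zero>" for q
      using min' that by simp
    \<comment> \<open>An element of \<open>G\<close> is determined to be zero by its first
      component, so a nonzero constant polynomial cannot have its value in
      \<open>\<epsilon>K\<close>; hence \<open>p\<close> has positive degree and its leading
      coefficient has a nonzero first component.\<close>
    have Gz: "g = \<zero>\<^bsub>B\<^esub>" if "g \<in> G" "fst g = \<zero>" for g
      using that G0[of "snd g"] by (cases g) (auto simp: Bs)
    have deg: "deg B p > 0"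
    proof (rule ccontr)
      assume "\<not> deg B p > 0"
      then have "deg B p = 0" by simp
      note c = const[OF p(1) this zero_closed]
      have "up_ring.coeff P p 0 = \<zero>\<^bsub>B\<^esub>"
        using c p(3) U.coeff_closed[OF p(1), of 0] by (intro Gz) (simp_all add: Bs(1))
      with c p(2) show False by simp
    qed
    define lc where "lc = up_ring.coeff P p (deg B p)"
    have lc: "lc \<in> G" "fst lc \<noteq> \<zero>"
      using U.lcoeff_nonzero[OF p(2,1)] U.coeff_closed[OF p(1), of "deg B p"] Gz[of lc]
      by (auto simp: lc_def Bs(1))
    then have lcR: "fst lc \<in> carrier R" using Gc by auto
    define u where "u = fst (ev \<zero> (U.up_deriv p))"
    define v where "v = snd (ev \<zero> p)"
    have uR: "u \<in> carrier R" and vR: "v \<in> carrier R"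
      unfolding u_def v_def using evc U.up_deriv_closed p by auto
    \<comment> \<open>\<open>u\<close> is the value of \<open>p'\<close> at \<open>x\<close>. Were
      it zero, \<open>p'\<close> would contradict the minimality of \<open>p\<close>: its degree is
      smaller, and it is nonzero because its coefficient in degree \<open>deg B p - 1\<close> is
      \<open>deg B p\<close> times \<open>lc\<close>.\<close>
    have u: "u \<noteq> \<zero>"
    proof
      assume "u = \<zero>"
      have d': "deg B (U.up_deriv p) < deg B p"
        using U.deg_aboveI[of "deg B p - 1" "U.up_deriv p"] p(1) deg
        by (force simp: U.coeff_up_deriv U.up_deriv_closed)
      have "up_ring.coeff P (U.up_deriv p) (deg B p - 1) = [deg B p] \<cdot>\<^bsub>B\<^esub> lc"
        using deg by (simp add: U.coeff_up_deriv[OF p(1)] lc_def del: B.add.nat_pow_Suc)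
      moreover have "fst ([n] \<cdot>\<^bsub>B\<^esub> lc) = [n] \<cdot> fst lc" for n :: nat
        using lc(1) by (induction n) (auto simp: Bs)
      moreover have "[deg B p] \<cdot> fst lc = ([deg B p] \<cdot> \<one>) \<otimes> fst lc"
        using lcR by (simp add: add_pow_ldistr)
      moreover have "\<dots> \<noteq> \<zero>" using char_zero[OF deg] lc lcR by (simp add: integral_iff)
      ultimately have "U.up_deriv p \<noteq> \<zero>\<^bsub>P\<^esub>" using U.coeff_zero by (metis Bs(2) fst_conv)
      from min[OF U.up_deriv_closed[OF p(1)] this] \<open>u = \<zero>\<close> d' show False by (simp add: u_def)
    qed
    \<comment> \<open>By the expansion in \<open>shift\<close> the second component of
      \<open>ev y p\<close> is \<open>v + uy\<close>, which this choice makes zero.\<close>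
    define y where "y = \<ominus> (v \<otimes> inv u)"
    have uU: "u \<in> Units R" using u uR field_Units by auto
    then have y: "y \<in> carrier R" using vR by (simp add: y_def)
    have "u \<otimes> y = \<ominus> v"
      unfolding y_def using uU uR vR by (subst r_minus, simp, simp, subst m_lcomm) auto
    then have evp: "ev y p = (\<zero>, \<zero>)"
      using shift[OF p(1) deg y] p(3) vR uR y evc[OF U.up_deriv_closed[OF p(1)], of \<zero>]
      by (simp add: E_def u_def[symmetric] v_def[symmetric] r_neg)
    interpret H: ring_hom_cring P E "ev y" by (rule ev[OF y])
    have "b = \<zero>" if mem: "(\<zero>, b) \<in> ev y ` carrier P" for b
    proof -
      obtain q where q: "q \<in> carrier P" "(\<zero>, b) = ev y q" using mem by (rule imageE)
      then have b: "b \<in> carrier R" using evc(2)[OF q(1) y] by (metis snd_conv)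
      \<comment> \<open>\<open>G\<close> is only a ring, so \<open>lc\<close> need not be invertible
        in it and \<open>q\<close> is divided only after multiplication by a power \<open>c\<close>
        of \<open>lc\<close>. As \<open>ev y p = 0\<close>, the value
        \<open>c(0, b) = (0, fst c * b)\<close> is that of \<open>r\<close>; minimality forces
        \<open>r = 0\<close>, and \<open>fst c \<noteq> 0\<close> is cancelled in the field.\<close>
      obtain d r k where dr: "d \<in> carrier P" "r \<in> carrier P"
        "lc [^]\<^bsub>B\<^esub> (k::nat) \<odot>\<^bsub>P\<^esub> q = p \<otimes>\<^bsub>P\<^esub> d \<oplus>\<^bsub>P\<^esub> r" "r = \<zero>\<^bsub>P\<^esub> \<or> deg B r < deg B p"
        using U.long_div_theorem[OF p(1) q(1) p(2)] unfolding lc_def by blast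
      define c where "c = lc [^]\<^bsub>B\<^esub> k"
      have cG: "c \<in> G" unfolding c_def using lc Bs(1) B.nat_pow_closed by metis
      have "fst c = fst lc [^] k" unfolding c_def
        by (induction k) (auto simp: B_def E_def)
      moreover have "fst lc [^] k \<in> carrier R \<and> fst lc [^] k \<noteq> \<zero>"
        using lcR lc(2) by (induction k) (auto simp: integral_iff)
      ultimately have c: "fst c \<in> carrier R" "fst c \<noteq> \<zero>" by simp_all
      have "snd c \<in> carrier R" using cG Gc by auto
      interpret W: UP_univ_prop B E id P "(x, y)" "ev y"
        by unfold_locales (simp_all add: xy y ev_def)
      have 1: "ev y (c \<odot>\<^bsub>P\<^esub> q) = c \<otimes>\<^bsub>E\<^esub> (\<zero>, b)"
        using W.Eval_smult[of c q] cG q(1) by (simp add: Bs q(2))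
      have 2: "ev y (p \<otimes>\<^bsub>P\<^esub> d \<oplus>\<^bsub>P\<^esub> r) = ev y r"
        using p dr evp evc[OF dr(1) y] evc[OF dr(2) y] by (simp add: E_def)
      have *: "(\<zero>, fst c \<otimes> b) = ev y r"
        using 1 2 dr(3) c b \<open>snd c \<in> carrier R\<close> by (simp add: c_def[symmetric] E_def)
      then have "fst (ev \<zero> r) = \<zero>" using fst_ev[OF dr(2) y] by (metis fst_conv)
      then have "r = \<zero>\<^bsub>P\<^esub>" using min[OF dr(2)] dr(4) by (meson not_le)
      then have "fst c \<otimes> b = \<zero>" using * H.hom_zero by (simp add: E_def)
      then show "b = \<zero>" using c b by (simp add: integral_iff)
    qed
    then have "graph_like R (ev y ` carrier P)"
      using image[OF y] by (auto simp: graph_like_def E_def)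
    then show ?thesis using image[OF y] y by blast
  qed
qed

text \<open>Both conditions of \<open>graph_like\<close> pass to unions of chains, so there is a
  maximal such subring \<open>M\<close> above \<open>G\<close>. The one-element extension makes it
  total, and it is single-valued because the difference of two elements over the same
  \<open>a\<close> lies in \<open>\<epsilon>K\<close>. Closure of \<open>M\<close> under sums and
  products then says that the function with graph \<open>M\<close> is a derivation.\<close>

lemma (in field) extend_derivation:
  assumes char_zero: "\<And>n :: nat. n > 0 \<Longrightarrow> [n] \<cdot> \<one> \<noteq> \<zero>" and G: "graph_like R G"
  obtains D where "derivation_along R R id D" "\<And>a b. (a, b) \<in> G \<Longrightarrow> D a = b"
proof -
  interpret E: cring "dual_ring R" by (rule cring_dual_ring)
  define \<G> where "\<G> = {H. graph_like R H \<and> G \<subseteq> H}"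
  have "G \<in> \<G>" using G by (simp add: \<G>_def)
  then have ne: "\<G> \<noteq> {}" by auto
  have "\<exists>M\<in>\<G>. \<forall>H\<in>\<G>. M \<subseteq> H \<longrightarrow> H = M"
  proof (rule subset_Zorn_nonempty[OF ne])
    fix C assume C: "C \<noteq> {}" "subset.chain \<G> C"
    then have sub: "\<And>H. H \<in> C \<Longrightarrow> subring H (dual_ring R)" by (auto simp: subset.chain_def \<G>_def graph_like_def)
    have two: "\<exists>H\<in>C. x \<in> H \<and> y \<in> H" if "x \<in> \<Union>C" "y \<in> \<Union>C" for x y
      using that C(2) unfolding subset.chain_def by blast
    obtain H0 where H0: "H0 \<in> C" using C by auto
    have "subring (\<Union>C) (dual_ring R)"
    proof (rule E.subringI)
      show "\<Union>C \<subseteq> carrier (dual_ring R)" using subringE(1)[OF sub] by blast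
      show "\<one>\<^bsub>dual_ring R\<^esub> \<in> \<Union>C" using subringE(3)[OF sub[OF H0]] H0 by blast
    next
      fix x assume "x \<in> \<Union>C"
      then show "\<ominus>\<^bsub>dual_ring R\<^esub> x \<in> \<Union>C" using subringE(5)[OF sub] by blast
    next
      fix x y assume "x \<in> \<Union>C" "y \<in> \<Union>C"
      then obtain H where "H \<in> C" "x \<in> H" "y \<in> H" using two by blast
      then show "x \<otimes>\<^bsub>dual_ring R\<^esub> y \<in> \<Union>C" "x \<oplus>\<^bsub>dual_ring R\<^esub> y \<in> \<Union>C"
        using subringE(6,7)[OF sub] by blast+
    qed
    moreover have "b = \<zero>" if "(\<zero>, b) \<in> \<Union>C" for b
      using that C(2) by (auto simp: subset.chain_def \<G>_def graph_like_def)
    moreover have "G \<subseteq> \<Union>C" using H0 C(2) unfolding subset.chain_def \<G>_def by blast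
    ultimately show "\<Union>C \<in> \<G>" by (simp add: \<G>_def graph_like_def)
  qed
  then obtain M where M: "graph_like R M" "G \<subseteq> M"
    and max: "\<And>H. graph_like R H \<Longrightarrow> M \<subseteq> H \<Longrightarrow> H = M"
    by (auto simp: \<G>_def)
  have sub: "subring M (dual_ring R)" and M0: "\<And>b. (\<zero>, b) \<in> M \<Longrightarrow> b = \<zero>"
    using M by (auto simp: graph_like_def)
  have Mc: "a \<in> carrier R \<and> b \<in> carrier R" if "(a, b) \<in> M" for a b
    using subringE(1)[OF sub] that by auto
  have total: "\<exists>b. (a, b) \<in> M" if a: "a \<in> carrier R" for a
    using graph_like_extend[OF char_zero M(1) a] max by blast
  have unique: "b = c" if bc: "(a, b) \<in> M" "(a, c) \<in> M" for a b c
  proof -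
    have "(a, b) \<oplus>\<^bsub>dual_ring R\<^esub> (\<ominus>\<^bsub>dual_ring R\<^esub> (a, c)) \<in> M"
      by (intro subringE(5,7)[OF sub] bc)
    then have "(\<zero>, b \<oplus> \<ominus> c) \<in> M" using Mc[OF bc(1)] Mc[OF bc(2)] by (simp add: dual_ring_a_inv r_neg)
    then have "b \<oplus> \<ominus> c = \<zero>" by (rule M0)
    then show ?thesis using Mc[OF bc(1)] Mc[OF bc(2)] by (simp add: r_right_minus_eq[unfolded a_minus_def])
  qed
  define D where "D a = (THE b. (a, b) \<in> M)" for a
  have D: "D a = b" if "(a, b) \<in> M" for a b
    unfolding D_def using that unique by blast
  have DM: "(a, D a) \<in> M" if "a \<in> carrier R" for a using total[OF that] D by blast
  show thesis
  proof
    show "derivation_along R R id D"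
      unfolding derivation_along_def
    proof (intro conjI ballI)
      show "D \<in> carrier R \<rightarrow> carrier R" using DM Mc by blast
    next
      fix a b assume ab: "a \<in> carrier R" "b \<in> carrier R"
      note c = ab Mc[OF DM[OF ab(1)]] Mc[OF DM[OF ab(2)]]
      show "D (a \<oplus> b) = D a \<oplus> D b"
        using subringE(7)[OF sub DM[OF ab(1)] DM[OF ab(2)]] by (intro D) simp
      show "D (a \<otimes> b) = id a \<otimes> D b \<oplus> id b \<otimes> D a"
        using subringE(6)[OF sub DM[OF ab(1)] DM[OF ab(2)]] c by (intro D) (simp add: m_comm)
    qed
    show "D a = b" if "(a, b) \<in> G" for a b using that M(2) by (intro D) blast
  qed
qed

section \<open>Homomorphisms into fields\<close>

text \<open>An ideal \<open>P\<close> maximal among those disjoint from \<open>S\<close> is prime: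
  if neither \<open>a\<close> nor \<open>b\<close> lies in \<open>P\<close>, then
  \<open>P + (a)\<close> and \<open>P + (b)\<close> both meet \<open>S\<close>. The product of the
  two common elements is again in \<open>S\<close>, but \<open>a \<otimes> b \<in> P\<close> would
  put it into \<open>P\<close>.\<close>

lemma (in cring) exists_primeideal_disjoint:
  assumes S: "S \<subseteq> carrier R" "\<one> \<in> S" "\<zero> \<notin> S"
    and mult: "\<And>a b. a \<in> S \<Longrightarrow> b \<in> S \<Longrightarrow> a \<otimes> b \<in> S"
  shows "\<exists>P. primeideal P R \<and> P \<inter> S = {}"
proof -
  define \<A> where "\<A> = {I. ideal I R \<and> I \<inter> S = {}}"
  have "{\<zero>} \<in> \<A>" using zeroideal S by (simp add: \<A>_def)
  then have ne: "\<A> \<noteq> {}" by auto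
  have "\<exists>M\<in>\<A>. \<forall>U\<in>\<A>. M \<subseteq> U \<longrightarrow> U = M"
  proof (rule subset_Zorn_nonempty[OF ne])
    fix C assume C: "C \<noteq> {}" "subset.chain \<A> C"
    then have "subset.chain {I. ideal I R} C" by (auto simp: subset.chain_def \<A>_def)
    then have "ideal (\<Union>C) R" using chain_Union_is_ideal C(1) by presburger
    moreover have "\<Union>C \<inter> S = {}" using C by (auto simp: subset.chain_def \<A>_def)
    ultimately show "\<Union>C \<in> \<A>" by (simp add: \<A>_def)
  qed
  then obtain P where P: "ideal P R" "P \<inter> S = {}"
    and max: "\<And>I. ideal I R \<Longrightarrow> I \<inter> S = {} \<Longrightarrow> P \<subseteq> I \<Longrightarrow> I = P"
    by (auto simp: \<A>_def)
  interpret P: ideal P R by fact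
  have meets: "\<exists>p\<in>P. \<exists>r\<in>carrier R. p \<oplus> r \<otimes> a \<in> S" if a: "a \<in> carrier R" "a \<notin> P" for a
  proof -
    have I: "ideal (P <+> PIdl a) R" by (rule add_ideals[OF P(1) cgenideal_ideal[OF a(1)]])
    have 1: "P \<subseteq> P <+> PIdl a"
    proof
      fix p assume p: "p \<in> P"
      then have "p = p \<oplus> \<zero> \<otimes> a" using a P.Icarr by simp
      then show "p \<in> P <+> PIdl a" using p unfolding set_add_def' cgenideal_def by blast
    qed
    have "a = \<zero> \<oplus> \<one> \<otimes> a" using a by simp
    then have "a \<in> P <+> PIdl a" unfolding set_add_def' cgenideal_def
      using P.zero_closed by blast
    then have "(P <+> PIdl a) \<inter> S \<noteq> {}" using max[OF I _ 1] a by auto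
    then show ?thesis by (auto simp: set_add_def' cgenideal_def)
  qed
  have "primeideal P R"
  proof (rule primeidealI[OF P(1)])
    show "cring R" by (rule cring_axioms)
    show "carrier R \<noteq> P" using P S by auto
  next
    fix a b assume ab: "a \<in> carrier R" "b \<in> carrier R" "a \<otimes> b \<in> P"
    show "a \<in> P \<or> b \<in> P"
    proof (rule ccontr)
      assume "\<not> ?thesis"
      then obtain p r q t where pr: "p \<in> P" "r \<in> carrier R" "p \<oplus> r \<otimes> a \<in> S"
        and qt: "q \<in> P" "t \<in> carrier R" "q \<oplus> t \<otimes> b \<in> S"
        using meets ab by metis
      have c: "p \<in> carrier R" "q \<in> carrier R" using pr qt P.Icarr by auto
      have "(p \<oplus> r \<otimes> a) \<otimes> (q \<oplus> t \<otimes> b) =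
        p \<otimes> (q \<oplus> t \<otimes> b) \<oplus> ((r \<otimes> a) \<otimes> q \<oplus> (r \<otimes> t) \<otimes> (a \<otimes> b))"
        using ab pr(2) qt(2) c by (simp add: l_distr r_distr m_ac a_ac)
      also have "\<dots> \<in> P"
        using ab pr qt c P.I_r_closed[OF pr(1)] P.I_l_closed[OF qt(1)] P.I_l_closed[OF ab(3)]
        by (intro P.a_closed) auto
      finally show False using mult[OF pr(3) qt(3)] P(2) by auto
    qed
  qed
  with P show ?thesis by blast
qed

section \<open>Fields of fractions of integral domains\<close>

definition fraction :: "('d, 'm) ring_scheme \<Rightarrow> 'd \<Rightarrow> 'd \<Rightarrow> ('d \<times> 'd) set" where
  "fraction D a s = {(b, t). b \<in> carrier D \<and> t \<in> carrier D - {\<zero>\<^bsub>D\<^esub>} \<and> a \<otimes>\<^bsub>D\<^esub> t = b \<otimes>\<^bsub>D\<^esub> s}"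

text \<open>A fraction is the class of all pairs that represent it, and the operations act on
  arbitrarily chosen representatives. Independence of the choice is the content of
  \<open>fraction_mult\<close> and \<open>fraction_add\<close>.\<close>

definition fraction_field :: "('d, 'm) ring_scheme \<Rightarrow> ('d \<times> 'd) set ring" where
  "fraction_field D = (let rep = (\<lambda>U. SOME p. p \<in> U) in
    \<lparr>carrier = {fraction D a s | a s. a \<in> carrier D \<and> s \<in> carrier D - {\<zero>\<^bsub>D\<^esub>}},
     monoid.mult = (\<lambda>U V. fraction D (fst (rep U) \<otimes>\<^bsub>D\<^esub> fst (rep V)) (snd (rep U) \<otimes>\<^bsub>D\<^esub> snd (rep V))),
     one = fraction D \<one>\<^bsub>D\<^esub> \<one>\<^bsub>D\<^esub>, ring.zero = fraction D \<zero>\<^bsub>D\<^esub> \<one>\<^bsub>D\<^esub>,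
     ring.add = (\<lambda>U V. fraction D
       (fst (rep U) \<otimes>\<^bsub>D\<^esub> snd (rep V) \<oplus>\<^bsub>D\<^esub> fst (rep V) \<otimes>\<^bsub>D\<^esub> snd (rep U)) (snd (rep U) \<otimes>\<^bsub>D\<^esub> snd (rep V)))\<rparr>)"

context "domain"
begin

text \<open>The substantial direction is the transitivity of cross multiplication: multiply by
  \<open>t\<close>, use the given equation, then cancel \<open>s\<close>, which is legitimate in a
  domain.\<close>

lemma fraction_eq_iff:
  assumes "a \<in> carrier R" "s \<in> carrier R - {\<zero>}" "b \<in> carrier R" "t \<in> carrier R - {\<zero>}"
  shows "fraction R a s = fraction R b t \<longleftrightarrow> a \<otimes> t = b \<otimes> s"
proof
  assume "fraction R a s = fraction R b t"
  moreover have "(a, s) \<in> fraction R a s" using assms by (simp add: fraction_def)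
  ultimately show "a \<otimes> t = b \<otimes> s" using assms by (auto simp: fraction_def)
next
  assume eq: "a \<otimes> t = b \<otimes> s"
  have "a \<otimes> v = c \<otimes> s \<longleftrightarrow> b \<otimes> v = c \<otimes> t" if "c \<in> carrier R" "v \<in> carrier R - {\<zero>}" for c v
  proof -
    have "a \<otimes> v = c \<otimes> s \<longleftrightarrow> t \<otimes> (a \<otimes> v) = t \<otimes> (c \<otimes> s)"
      using assms that by (simp add: m_lcancel)
    also have "t \<otimes> (a \<otimes> v) = (a \<otimes> t) \<otimes> v" using assms that by (simp add: m_ac)
    also have "\<dots> = s \<otimes> (b \<otimes> v)" unfolding eq using assms that by (simp add: m_ac)
    also have "t \<otimes> (c \<otimes> s) = s \<otimes> (c \<otimes> t)" using assms that by (simp add: m_ac)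
    finally show ?thesis using assms that by (simp add: m_lcancel)
  qed
  then show "fraction R a s = fraction R b t" by (auto simp: fraction_def)
qed

lemma fraction_rep:
  assumes "a \<in> carrier R" "s \<in> carrier R - {\<zero>}"
  obtains b t where "(SOME p. p \<in> fraction R a s) = (b, t)" "b \<in> carrier R" "t \<in> carrier R - {\<zero>}"
    "a \<otimes> t = b \<otimes> s"
proof -
  have "(a, s) \<in> fraction R a s" using assms by (simp add: fraction_def)
  then have "(SOME p. p \<in> fraction R a s) \<in> fraction R a s" by (rule someI)
  then show thesis using that by (cases "SOME p. p \<in> fraction R a s") (auto simp: fraction_def)
qed

lemma fraction_mult:
  assumes a: "a \<in> carrier R" "s \<in> carrier R - {\<zero>}" and b: "b \<in> carrier R" "t \<in> carrier R - {\<zero>}"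
  shows "fraction R a s \<otimes>\<^bsub>fraction_field R\<^esub> fraction R b t = fraction R (a \<otimes> b) (s \<otimes> t)"
proof -
  obtain a' s' where 1: "(SOME p. p \<in> fraction R a s) = (a', s')" "a' \<in> carrier R" "s' \<in> carrier R - {\<zero>}"
    "a \<otimes> s' = a' \<otimes> s" by (rule fraction_rep[OF a])
  obtain b' t' where 2: "(SOME p. p \<in> fraction R b t) = (b', t')" "b' \<in> carrier R" "t' \<in> carrier R - {\<zero>}"
    "b \<otimes> t' = b' \<otimes> t" by (rule fraction_rep[OF b])
  have "fraction R (a' \<otimes> b') (s' \<otimes> t') = fraction R (a \<otimes> b) (s \<otimes> t)"
  proof (subst fraction_eq_iff)
    have "a' \<otimes> b' \<otimes> (s \<otimes> t) = (a' \<otimes> s) \<otimes> (b' \<otimes> t)" using a b 1(2,3) 2(2,3) by (simp add: m_ac)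
    also have "\<dots> = a \<otimes> b \<otimes> (s' \<otimes> t')"
      unfolding 1(4)[symmetric] 2(4)[symmetric] using a b 1(2,3) 2(2,3) by (simp add: m_ac)
    finally show "a' \<otimes> b' \<otimes> (s \<otimes> t) = a \<otimes> b \<otimes> (s' \<otimes> t')" .
  qed (use a b 1 2 in \<open>auto simp: integral_iff\<close>)
  then show ?thesis by (simp add: fraction_field_def 1(1) 2(1))
qed

lemma fraction_add:
  assumes a: "a \<in> carrier R" "s \<in> carrier R - {\<zero>}" and b: "b \<in> carrier R" "t \<in> carrier R - {\<zero>}"
  shows "fraction R a s \<oplus>\<^bsub>fraction_field R\<^esub> fraction R b t = fraction R (a \<otimes> t \<oplus> b \<otimes> s) (s \<otimes> t)"
proof -
  obtain a' s' where 1: "(SOME p. p \<in> fraction R a s) = (a', s')" "a' \<in> carrier R" "s' \<in> carrier R - {\<zero>}"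
    "a \<otimes> s' = a' \<otimes> s" by (rule fraction_rep[OF a])
  obtain b' t' where 2: "(SOME p. p \<in> fraction R b t) = (b', t')" "b' \<in> carrier R" "t' \<in> carrier R - {\<zero>}"
    "b \<otimes> t' = b' \<otimes> t" by (rule fraction_rep[OF b])
  have "fraction R (a' \<otimes> t' \<oplus> b' \<otimes> s') (s' \<otimes> t') = fraction R (a \<otimes> t \<oplus> b \<otimes> s) (s \<otimes> t)"
  proof (subst fraction_eq_iff)
    have "(a' \<otimes> t' \<oplus> b' \<otimes> s') \<otimes> (s \<otimes> t) = (a' \<otimes> s) \<otimes> (t' \<otimes> t) \<oplus> (b' \<otimes> t) \<otimes> (s' \<otimes> s)"
      using a b 1(2,3) 2(2,3) by (simp add: m_ac l_distr r_distr)
    also have "\<dots> = (a \<otimes> t \<oplus> b \<otimes> s) \<otimes> (s' \<otimes> t')"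
      unfolding 1(4)[symmetric] 2(4)[symmetric] using a b 1(2,3) 2(2,3) by (simp add: m_ac l_distr r_distr)
    finally show "(a' \<otimes> t' \<oplus> b' \<otimes> s') \<otimes> (s \<otimes> t) = (a \<otimes> t \<oplus> b \<otimes> s) \<otimes> (s' \<otimes> t')" .
  qed (use a b 1 2 in \<open>auto simp: integral_iff\<close>)
  then show ?thesis by (simp add: fraction_field_def 1(1) 2(1))
qed

lemma field_fraction_field: "field (fraction_field R)"
proof -
  let ?Q = "fraction_field R"
  have rep: "\<exists>a s. a \<in> carrier R \<and> s \<in> carrier R - {\<zero>} \<and> U = fraction R a s" if "U \<in> carrier ?Q" for U
    using that by (auto simp: fraction_field_def)
  have inQ: "fraction R a s \<in> carrier ?Q" if "a \<in> carrier R" "s \<in> carrier R - {\<zero>}" for a s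
    using that by (auto simp: fraction_field_def)
  have one: "\<one>\<^bsub>?Q\<^esub> = fraction R \<one> \<one>" and zero: "\<zero>\<^bsub>?Q\<^esub> = fraction R \<zero> \<one>"
    by (simp_all add: fraction_field_def)
  note s = one zero inQ fraction_mult fraction_add fraction_eq_iff integral_iff
  have Q: "cring ?Q"
  proof (rule cringI)
    show "abelian_group ?Q"
    proof (rule abelian_groupI)
      fix U assume "U \<in> carrier ?Q"
      then obtain a s where "a \<in> carrier R" "s \<in> carrier R - {\<zero>}" "U = fraction R a s"
        using rep by blast
      then show "\<exists>V\<in>carrier ?Q. V \<oplus>\<^bsub>?Q\<^esub> U = \<zero>\<^bsub>?Q\<^esub>"
        by (intro bexI[of _ "fraction R (\<ominus> a) s"]) (auto simp: s l_minus l_neg)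
    next
      fix U V assume "U \<in> carrier ?Q" "V \<in> carrier ?Q"
      then show "U \<oplus>\<^bsub>?Q\<^esub> V \<in> carrier ?Q" by (elim rep[elim_format] exE conjE) (simp add: s)
    qed (auto dest!: rep simp: s l_distr r_distr m_ac a_ac)
    show "comm_monoid ?Q"
    proof (rule comm_monoidI)
      fix U V assume "U \<in> carrier ?Q" "V \<in> carrier ?Q"
      then show "U \<otimes>\<^bsub>?Q\<^esub> V \<in> carrier ?Q" by (elim rep[elim_format] exE conjE) (simp add: s)
    qed (auto dest!: rep simp: s m_ac)
  next
    fix U V W assume "U \<in> carrier ?Q" "V \<in> carrier ?Q" "W \<in> carrier ?Q"
    then show "(U \<oplus>\<^bsub>?Q\<^esub> V) \<otimes>\<^bsub>?Q\<^esub> W = U \<otimes>\<^bsub>?Q\<^esub> W \<oplus>\<^bsub>?Q\<^esub> V \<otimes>\<^bsub>?Q\<^esub> W"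
      by (elim rep[elim_format] exE conjE) (simp add: s l_distr r_distr m_ac a_ac)
  qed
  show ?thesis
  proof (rule cring.cring_fieldI2[OF Q])
    show "\<zero>\<^bsub>?Q\<^esub> \<noteq> \<one>\<^bsub>?Q\<^esub>" by (simp add: s)
  next
    fix U assume U: "U \<in> carrier ?Q" "U \<noteq> \<zero>\<^bsub>?Q\<^esub>"
    then obtain a s where as: "a \<in> carrier R" "s \<in> carrier R - {\<zero>}" "U = fraction R a s"
      using rep by blast
    with U have "a \<noteq> \<zero>" by (auto simp: s)
    with as show "\<exists>V\<in>carrier ?Q. U \<otimes>\<^bsub>?Q\<^esub> V = \<one>\<^bsub>?Q\<^esub>"
      by (intro bexI[of _ "fraction R s a"]) (auto simp: s m_ac)
  qed
qed

lemma fraction_field_embedding: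
  "(\<lambda>a. fraction R a \<one>) \<in> ring_hom R (fraction_field R)" "inj_on (\<lambda>a. fraction R a \<one>) (carrier R)"
proof -
  show "(\<lambda>a. fraction R a \<one>) \<in> ring_hom R (fraction_field R)"
  proof (rule ring_hom_memI)
    fix a assume "a \<in> carrier R"
    then show "fraction R a \<one> \<in> carrier (fraction_field R)"
      unfolding fraction_field_def by (simp, intro exI[of _ a] exI[of _ \<one>]) simp
  qed (simp_all add: fraction_mult fraction_add, simp add: fraction_field_def)
  show "inj_on (\<lambda>a. fraction R a \<one>) (carrier R)"
    by (rule inj_onI) (simp add: fraction_eq_iff)
qed

end

text \<open>The type of \<open>K\<close> is explicit because types cannot be quantified
  existentially: elements of \<open>A/P\<close> are sets over \<open>'a\<close>, and fractions are
  sets of pairs of these. A member of \<open>S\<close> lies outside \<open>P\<close>, so its class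
  in \<open>A/P\<close> is nonzero and stays so in the field of fractions.\<close>

lemma exists_field_hom:
  fixes A :: "('a, 'n) ring_scheme"
  assumes "cring A" and S: "S \<subseteq> carrier A" "\<one>\<^bsub>A\<^esub> \<in> S" "\<zero>\<^bsub>A\<^esub> \<notin> S"
    and mult: "\<And>a b. a \<in> S \<Longrightarrow> b \<in> S \<Longrightarrow> a \<otimes>\<^bsub>A\<^esub> b \<in> S"
  obtains K :: "('a set \<times> 'a set) set ring" and \<phi>
  where "field K" "\<phi> \<in> ring_hom A K" "\<And>a. a \<in> S \<Longrightarrow> \<phi> a \<noteq> \<zero>\<^bsub>K\<^esub>"
proof -
  interpret cring A by fact
  obtain P where P: "primeideal P A" "P \<inter> S = {}"
    using exists_primeideal_disjoint[OF S mult] by blast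
  interpret P: primeideal P A by fact
  let ?Q = "A Quot P"
  interpret Q: "domain" ?Q by (rule P.quotient_is_domain)
  define \<phi> where "\<phi> = (\<lambda>a. fraction ?Q a \<one>\<^bsub>?Q\<^esub>) \<circ> (\<lambda>a. P +>\<^bsub>A\<^esub> a)"
  have hom: "\<phi> \<in> ring_hom A (fraction_field ?Q)"
    unfolding \<phi>_def by (rule ring_hom_trans[OF P.rcos_ring_hom Q.fraction_field_embedding(1)])
  have "\<phi> a \<noteq> \<zero>\<^bsub>fraction_field ?Q\<^esub>" if a: "a \<in> S" for a
  proof
    assume "\<phi> a = \<zero>\<^bsub>fraction_field ?Q\<^esub>"
    then have "fraction ?Q (P +>\<^bsub>A\<^esub> a) \<one>\<^bsub>?Q\<^esub> = fraction ?Q \<zero>\<^bsub>?Q\<^esub> \<one>\<^bsub>?Q\<^esub>"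
      by (simp add: \<phi>_def fraction_field_def)
    moreover have "P +>\<^bsub>A\<^esub> a \<in> carrier ?Q" using a S ring_hom_closed[OF P.rcos_ring_hom] by blast
    ultimately have "P +>\<^bsub>A\<^esub> a = \<zero>\<^bsub>?Q\<^esub>"
      by (intro inj_onD[OF Q.fraction_field_embedding(2)] Q.zero_closed)
    then have "P +>\<^bsub>A\<^esub> a = P" by (simp add: FactRing_def)
    then have "a \<in> P" using P.a_rcos_self a S by blast
    with P(2) a show False by blast
  qed
  with Q.field_fraction_field hom show thesis by (rule that)
qed

section \<open>Linear forms on differentials\<close>

text \<open>These are the \<open>R\<close>-linear maps from \<open>M\<close> to \<open>K\<close>
  with \<open>R\<close> acting on \<open>K\<close> through \<open>\<phi>\<close>; stating it this
  way avoids both a module structure on \<open>K\<close> and a base change of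
  \<open>M\<close>.\<close>

definition linear_along ::
    "('r, 'm) ring_scheme \<Rightarrow> ('r, 'b, 'n) module_scheme \<Rightarrow> ('c, 'o) ring_scheme \<Rightarrow> ('r \<Rightarrow> 'c) \<Rightarrow> ('b \<Rightarrow> 'c) \<Rightarrow> bool" where
  "linear_along R M K \<phi> L \<longleftrightarrow> L \<in> carrier M \<rightarrow> carrier K \<and>
     (\<forall>x\<in>carrier M. \<forall>y\<in>carrier M. L (x \<oplus>\<^bsub>M\<^esub> y) = L x \<oplus>\<^bsub>K\<^esub> L y) \<and>
     (\<forall>r\<in>carrier R. \<forall>x\<in>carrier M. L (r \<odot>\<^bsub>M\<^esub> x) = \<phi> r \<otimes>\<^bsub>K\<^esub> L x)"

lemma linear_alongD:
  assumes "linear_along R M K \<phi> L" "x \<in> carrier M"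
  shows "L x \<in> carrier K"
    and "y \<in> carrier M \<Longrightarrow> L (x \<oplus>\<^bsub>M\<^esub> y) = L x \<oplus>\<^bsub>K\<^esub> L y"
    and "r \<in> carrier R \<Longrightarrow> L (r \<odot>\<^bsub>M\<^esub> x) = \<phi> r \<otimes>\<^bsub>K\<^esub> L x"
  using assms by (auto simp: linear_along_def)

lemma linear_along_minus:
  assumes "module R M" "cring K" and L: "linear_along R M K \<phi> L"
    and xy: "x \<in> carrier M" "y \<in> carrier M"
  shows "L (x \<ominus>\<^bsub>M\<^esub> y) = L x \<ominus>\<^bsub>K\<^esub> L y"
proof -
  interpret module R M by fact
  interpret K: cring K by fact
  have "L (x \<ominus>\<^bsub>M\<^esub> y) \<oplus>\<^bsub>K\<^esub> L y = L (x \<ominus>\<^bsub>M\<^esub> y \<oplus>\<^bsub>M\<^esub> y)" using xy by (simp add: linear_alongD[OF L])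
  also have "x \<ominus>\<^bsub>M\<^esub> y \<oplus>\<^bsub>M\<^esub> y = x" using xy by (simp add: a_minus_def M.a_assoc M.l_neg)
  finally have *: "L (x \<ominus>\<^bsub>M\<^esub> y) \<oplus>\<^bsub>K\<^esub> L y = L x" .
  show ?thesis unfolding *[symmetric]
    using xy by (simp add: a_minus_def K.a_assoc K.r_neg linear_alongD(1)[OF L])
qed

lemma linear_along_zero:
  assumes "module R M" "cring K" and L: "linear_along R M K \<phi> L"
  shows "L \<zero>\<^bsub>M\<^esub> = \<zero>\<^bsub>K\<^esub>"
proof -
  interpret module R M by fact
  interpret K: cring K by fact
  have "L \<zero>\<^bsub>M\<^esub> \<oplus>\<^bsub>K\<^esub> L \<zero>\<^bsub>M\<^esub> = L \<zero>\<^bsub>M\<^esub>"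
    using linear_alongD(2)[OF L, of "\<zero>\<^bsub>M\<^esub>" "\<zero>\<^bsub>M\<^esub>"] by simp
  then show ?thesis using linear_alongD(1)[OF L, of "\<zero>\<^bsub>M\<^esub>"] by (simp add: K.add.l_cancel_one')
qed

text \<open>The kernel of \<open>L\<close> is a submodule containing \<open>S\<close>, and the span
  is the least such submodule.\<close>

lemma linear_along_span:
  assumes M: "module R M" and K: "cring K" and \<phi>: "\<phi> \<in> ring_hom R K" and L: "linear_along R M K \<phi> L"
    and S: "S \<subseteq> carrier M" "\<And>x. x \<in> S \<Longrightarrow> L x = \<zero>\<^bsub>K\<^esub>" and x: "x \<in> submodule_span R M S"
  shows "L x = \<zero>\<^bsub>K\<^esub>"
proof -
  interpret module R M by fact
  interpret K: cring K by fact
  let ?N = "{x \<in> carrier M. L x = \<zero>\<^bsub>K\<^esub>}"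
  have "submodule ?N R M"
  proof (rule submoduleI)
    fix a assume "a \<in> ?N"
    then show "\<ominus>\<^bsub>M\<^esub> a \<in> ?N"
      using linear_along_minus[OF M K L, of "\<zero>\<^bsub>M\<^esub>" a] linear_along_zero[OF M K L]
      by (simp add: a_minus_def)
  qed (auto simp: linear_alongD[OF L] linear_along_zero[OF M K L] ring_hom_closed[OF \<phi>])
  then have "submodule_span R M S \<subseteq> ?N" using S unfolding submodule_span_def by blast
  with x show ?thesis by blast
qed

lemma linear_along_quotient:
  assumes M: "module R M" and N: "submodule N R M" and K: "cring K"
    and L: "linear_along R M K \<phi> L" and Lzero: "\<And>x. x \<in> N \<Longrightarrow> L x = \<zero>\<^bsub>K\<^esub>"
  obtains \<beta> where "linear_along R (quotient_module M N) K \<phi> \<beta>"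
    "\<And>x. x \<in> carrier M \<Longrightarrow> \<beta> (N +>\<^bsub>M\<^esub> x) = L x"
proof
  interpret module R M by fact
  interpret K: cring K by fact
  interpret N: abelian_subgroup N M
    by (intro abelian_subgroupI3 additive_subgroup.intro submodule.axioms(1)[OF N]) unfold_locales
  let ?Q = "quotient_module M N"
  define \<beta> where "\<beta> U = L (SOME x. x \<in> U)" for U
  show \<beta>: "\<beta> (N +>\<^bsub>M\<^esub> x) = L x" if x: "x \<in> carrier M" for x
  proof -
    have "x \<in> N +>\<^bsub>M\<^esub> x" using N.a_rcos_self x by blast
    then have "(SOME y. y \<in> N +>\<^bsub>M\<^esub> x) \<in> N +>\<^bsub>M\<^esub> x" by (rule someI)
    then obtain n where n: "n \<in> N" "(SOME y. y \<in> N +>\<^bsub>M\<^esub> x) = n \<oplus>\<^bsub>M\<^esub> x"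
      by (auto simp: a_r_coset_def')
    moreover have "n \<in> carrier M" using n N.a_subset by auto
    ultimately show ?thesis using x Lzero by (simp add: \<beta>_def linear_alongD[OF L])
  qed
  have rep: "\<exists>x\<in>carrier M. U = N +>\<^bsub>M\<^esub> x" if "U \<in> carrier ?Q" for U
    using that by (auto simp: quotient_module_def A_RCOSETS_def')
  have add: "(N +>\<^bsub>M\<^esub> x) \<oplus>\<^bsub>?Q\<^esub> (N +>\<^bsub>M\<^esub> y) = N +>\<^bsub>M\<^esub> (x \<oplus>\<^bsub>M\<^esub> y)"
    if "x \<in> carrier M" "y \<in> carrier M" for x y
    using that N.a_rcos_sum by (simp add: quotient_module_def)
  show "linear_along R ?Q K \<phi> \<beta>"
    unfolding linear_along_def
    by (auto dest!: rep simp: add \<beta> quotient_smult[OF M N] linear_alongD[OF L])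
qed

section \<open>Forms on free modules and the universal property of differentials\<close>

text \<open>The sum runs over the support of \<open>f\<close>, since the bases in use (all of
  \<open>A\<close>, all tuples of differentials) may be infinite and \<open>finsum\<close> over an
  infinite set is zero.\<close>

definition lin_ext ::
    "('r, 'm) ring_scheme \<Rightarrow> ('c, 'n) ring_scheme \<Rightarrow> ('r \<Rightarrow> 'c) \<Rightarrow> ('x \<Rightarrow> 'c) \<Rightarrow> ('x \<Rightarrow> 'r) \<Rightarrow> 'c" where
  "lin_ext R K \<phi> w f = (\<Oplus>\<^bsub>K\<^esub>x\<in>{x. f x \<noteq> \<zero>\<^bsub>R\<^esub>}. \<phi> (f x) \<otimes>\<^bsub>K\<^esub> w x)"

lemma free_moduleD:
  assumes "cring R" "f \<in> carrier (free_module R B)"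
  shows "f x \<in> carrier R" "finite {x. f x \<noteq> \<zero>\<^bsub>R\<^esub>}" "{x. f x \<noteq> \<zero>\<^bsub>R\<^esub>} \<subseteq> B"
proof -
  interpret cring R by fact
  show "f x \<in> carrier R" using assms(2) by (cases "x \<in> B") (auto simp: free_module_def)
  show "finite {x. f x \<noteq> \<zero>\<^bsub>R\<^esub>}" "{x. f x \<noteq> \<zero>\<^bsub>R\<^esub>} \<subseteq> B"
    using assms(2) by (auto simp: free_module_def)
qed

context ring_hom_cring
begin

text \<open>The supports of \<open>f\<close>, \<open>g\<close> and their sum differ; additivity is
  checked after all three sums are moved to a common finite index set.\<close>

lemma lin_ext_superset:
  assumes f: "f \<in> carrier (free_module R B)" and w: "w \<in> B \<rightarrow> carrier S"
    and T: "finite T" "{x. f x \<noteq> \<zero>} \<subseteq> T" "T \<subseteq> B"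
  shows "lin_ext R S h w f = (\<Oplus>\<^bsub>S\<^esub>x\<in>T. h (f x) \<otimes>\<^bsub>S\<^esub> w x)"
  unfolding lin_ext_def
  using free_moduleD[OF R.cring_axioms f] w T
  by (intro S.add.finprod_mono_neutral_cong_left) (auto simp: Pi_iff subset_iff)

lemma lin_ext_free_gen:
  assumes "w \<in> B \<rightarrow> carrier S" "x \<in> B"
  shows "lin_ext R S h w (free_gen R x) = w x"
proof -
  have "lin_ext R S h w (free_gen R x) = (\<Oplus>\<^bsub>S\<^esub>y\<in>{x}. h (free_gen R x y) \<otimes>\<^bsub>S\<^esub> w y)"
    using assms by (intro lin_ext_superset free_gen_closed R.cring_axioms) (auto simp: free_gen_def)
  then show ?thesis using assms by (simp add: free_gen_def Pi_iff)
qed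

lemma linear_along_lin_ext:
  assumes w: "w \<in> B \<rightarrow> carrier S"
  shows "linear_along R (free_module R B) S h (lin_ext R S h w)"
  unfolding linear_along_def
proof (intro conjI ballI)
  let ?F = "free_module R B"
  interpret F: module R ?F by (rule module_free_module[OF R.cring_axioms])
  note D = free_moduleD[OF R.cring_axioms]
  have wc: "x \<in> B \<Longrightarrow> w x \<in> carrier S" for x using w by auto
  show "lin_ext R S h w \<in> carrier ?F \<rightarrow> carrier S"
  proof
    fix f assume f: "f \<in> carrier ?F"
    show "lin_ext R S h w f \<in> carrier S"
      unfolding lin_ext_def using D[OF f] wc by (intro S.finsum_closed) auto
  qed
  fix f assume f: "f \<in> carrier ?F"
  {
    fix g assume g: "g \<in> carrier ?F"
    define T where "T = {x. f x \<noteq> \<zero>} \<union> {x. g x \<noteq> \<zero>}"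
    have T: "finite T" "T \<subseteq> B" using D(2,3)[OF f] D(2,3)[OF g] by (auto simp: T_def)
    have fg: "f \<oplus>\<^bsub>?F\<^esub> g = (\<lambda>x. f x \<oplus> g x)" by (simp add: free_module_def)
    have "lin_ext R S h w (f \<oplus>\<^bsub>?F\<^esub> g) = (\<Oplus>\<^bsub>S\<^esub>x\<in>T. h (f x \<oplus> g x) \<otimes>\<^bsub>S\<^esub> w x)"
      using lin_ext_superset[OF F.M.a_closed[OF f g] w T(1) _ T(2)] D(1)[OF f] D(1)[OF g]
      by (force simp: fg T_def)
    also have "\<dots> = (\<Oplus>\<^bsub>S\<^esub>x\<in>T. h (f x) \<otimes>\<^bsub>S\<^esub> w x \<oplus>\<^bsub>S\<^esub> h (g x) \<otimes>\<^bsub>S\<^esub> w x)"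
      using D(1)[OF f] D(1)[OF g] T wc by (intro S.finsum_cong') (auto simp: S.l_distr)
    also have "\<dots> = lin_ext R S h w f \<oplus>\<^bsub>S\<^esub> lin_ext R S h w g"
      using D(1)[OF f] D(1)[OF g] T wc
      by (subst S.finsum_addf) (auto simp: lin_ext_superset[OF f w, of T] lin_ext_superset[OF g w, of T] T_def)
    finally show "lin_ext R S h w (f \<oplus>\<^bsub>?F\<^esub> g) = lin_ext R S h w f \<oplus>\<^bsub>S\<^esub> lin_ext R S h w g" .
  }
  fix r assume r: "r \<in> carrier R"
  let ?T = "{x. f x \<noteq> \<zero>}"
  have rf: "r \<odot>\<^bsub>?F\<^esub> f = (\<lambda>x. r \<otimes> f x)" by (simp add: free_module_def)
  have "lin_ext R S h w (r \<odot>\<^bsub>?F\<^esub> f) = (\<Oplus>\<^bsub>S\<^esub>x\<in>?T. h (r \<otimes> f x) \<otimes>\<^bsub>S\<^esub> w x)"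
    using lin_ext_superset[OF F.smult_closed[OF r f] w D(2)[OF f] _ D(3)[OF f]] r D(1)[OF f]
    by (force simp: rf)
  also have "\<dots> = (\<Oplus>\<^bsub>S\<^esub>x\<in>?T. h r \<otimes>\<^bsub>S\<^esub> (h (f x) \<otimes>\<^bsub>S\<^esub> w x))"
    using D[OF f] r wc by (intro S.finsum_cong') (auto simp: S.m_assoc)
  also have "\<dots> = h r \<otimes>\<^bsub>S\<^esub> lin_ext R S h w f"
    unfolding lin_ext_def using D[OF f] r wc by (subst S.finsum_rdistr) auto
  finally show "lin_ext R S h w (r \<odot>\<^bsub>?F\<^esub> f) = h r \<otimes>\<^bsub>S\<^esub> lin_ext R S h w f" .
qed

end

text \<open>The existence half of the universal property. The linear extension of \<open>D\<close>
  to the free module kills the three families of relations by additivity, by the Leibniz rule and by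
  the assumption on constants.\<close>

lemma derivation_kaehler:
  assumes alg: "algebra k A" and K: "cring K" and \<phi>: "\<phi> \<in> ring_hom A K"
    and D: "derivation_along A K \<phi> D" and const: "\<And>c. c \<in> carrier k \<Longrightarrow> D (c \<odot>\<^bsub>A\<^esub> \<one>\<^bsub>A\<^esub>) = \<zero>\<^bsub>K\<^esub>"
  obtains \<beta> where "linear_along A (kaehler k A) K \<phi> \<beta>"
    "\<And>a. a \<in> carrier A \<Longrightarrow> \<beta> (kaehler_d k A a) = D a"
proof -
  interpret algebra k A by fact
  interpret A: cring A by (rule M_cring)
  interpret K: cring K by fact
  interpret h: ring_hom_cring A K \<phi> by (rule ring_hom_cringI[OF M_cring K \<phi>])
  let ?F = "free_module A (carrier A)"
  interpret F: module A ?F by (rule module_free_module[OF M_cring])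
  define L where "L = lin_ext A K \<phi> D"
  have w: "D \<in> carrier A \<rightarrow> carrier K" using D by (simp add: derivation_along_def)
  have L: "linear_along A ?F K \<phi> L" unfolding L_def by (rule h.linear_along_lin_ext[OF w])
  have Lg: "L (free_gen A a) = D a" if "a \<in> carrier A" for a
    unfolding L_def by (rule h.lin_ext_free_gen[OF w that])
  have g: "free_gen A a \<in> carrier ?F" if "a \<in> carrier A" for a using that by (intro free_gen_closed M_cring)
  note s = linear_along_minus[OF F.module_axioms K L] linear_alongD[OF L] Lg g derivation_alongD[OF D]
  have rel: "f \<in> carrier ?F \<and> L f = \<zero>\<^bsub>K\<^esub>" if "f \<in> kaehler_relations k A" for f
    using that unfolding kaehler_relations_def Let_def
    by (auto simp: s const a_minus_def[of K] K.r_neg)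
  have zero: "L x = \<zero>\<^bsub>K\<^esub>" if "x \<in> kaehler_submodule k A" for x
    using that unfolding kaehler_submodule_def
    by (rule linear_along_span[OF F.module_axioms K \<phi> L, rotated 2]) (use rel in auto)
  obtain \<beta> where "linear_along A (kaehler k A) K \<phi> \<beta>"
      "\<And>x. x \<in> carrier ?F \<Longrightarrow> \<beta> (kaehler_submodule k A +>\<^bsub>?F\<^esub> x) = L x"
    unfolding kaehler_def
    using linear_along_quotient[OF F.module_axioms submodule_kaehler_submodule[OF alg] K L zero] by metis
  then show thesis using that by (simp add: kaehler_d_def g Lg)
qed

section \<open>Alternating forms\<close>

text \<open>Splitting the Leibniz formula into even and odd permutations avoids signs.\<close>

definition perm_sum ::
    "('c, 'n) ring_scheme \<Rightarrow> nat \<Rightarrow> (nat \<Rightarrow> 'b \<Rightarrow> 'c) \<Rightarrow> (nat \<Rightarrow> nat) set \<Rightarrow> 'b list \<Rightarrow> 'c" where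
  "perm_sum K s \<beta> Q xs = (\<Oplus>\<^bsub>K\<^esub>\<pi>\<in>Q. \<Otimes>\<^bsub>K\<^esub>j\<in>{..<s}. \<beta> (\<pi> j) (xs ! j))"

definition alt_form ::
    "('c, 'n) ring_scheme \<Rightarrow> nat \<Rightarrow> (nat \<Rightarrow> 'b \<Rightarrow> 'c) \<Rightarrow> 'b list \<Rightarrow> 'c" where
  "alt_form K s \<beta> xs =
    perm_sum K s \<beta> {\<pi>. \<pi> permutes {..<s} \<and> evenperm \<pi>} xs \<ominus>\<^bsub>K\<^esub>
    perm_sum K s \<beta> {\<pi>. \<pi> permutes {..<s} \<and> \<not> evenperm \<pi>} xs"

lemma permutes_lessThan: "\<pi> permutes {..<s} \<Longrightarrow> j < s \<Longrightarrow> \<pi> j < s"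
  for s :: nat
  using permutes_in_image[of \<pi> "{..<s}" j] by simp

context cring
begin

lemma perm_sum_closed:
  assumes "\<And>\<pi>. \<pi> \<in> Q \<Longrightarrow> \<pi> permutes {..<s}"
    and "\<And>i j. i < s \<Longrightarrow> j < s \<Longrightarrow> \<beta> i (xs ! j) \<in> carrier R"
  shows "perm_sum R s \<beta> Q xs \<in> carrier R"
  unfolding perm_sum_def using assms
  by (intro finsum_closed Pi_I finprod_closed) (simp add: permutes_lessThan)

text \<open>The factor at position \<open>i\<close> is isolated and the remaining product does not
  see that position, so linearity in the \<open>i\<close>-th entry reduces to distributivity.
  \<open>Q\<close> is kept general to cover the even and the odd permutations at once.\<close>

lemma perm_sum_update:
  assumes "\<And>\<pi>. \<pi> \<in> Q \<Longrightarrow> \<pi> permutes {..<s}" "length xs = s" "i < s"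
    and "\<And>i j. i < s \<Longrightarrow> j < s \<Longrightarrow> \<beta> i (xs ! j) \<in> carrier R"
    and "\<And>i. i < s \<Longrightarrow> \<beta> i x \<in> carrier R"
  shows "perm_sum R s \<beta> Q (xs[i := x]) =
    (\<Oplus>\<pi>\<in>Q. \<beta> (\<pi> i) x \<otimes> (\<Otimes>j\<in>{..<s} - {i}. \<beta> (\<pi> j) (xs ! j)))"
  unfolding perm_sum_def
proof (rule finsum_cong')
  fix \<pi> assume "\<pi> \<in> Q"
  then have \<pi>: "\<pi> j < s" if "j < s" for j using assms(1) that permutes_lessThan by blast
  have "{..<s} = insert i ({..<s} - {i})" using assms by auto
  then have "(\<Otimes>j\<in>{..<s}. \<beta> (\<pi> j) (xs[i := x] ! j)) =
      (\<Otimes>j\<in>insert i ({..<s} - {i}). \<beta> (\<pi> j) (xs[i := x] ! j))" by simp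
  also have "\<dots> = \<beta> (\<pi> i) x \<otimes> (\<Otimes>j\<in>{..<s} - {i}. \<beta> (\<pi> j) (xs[i := x] ! j))"
    using assms \<pi> by (subst finprod_insert) auto
  also have "(\<Otimes>j\<in>{..<s} - {i}. \<beta> (\<pi> j) (xs[i := x] ! j)) = (\<Otimes>j\<in>{..<s} - {i}. \<beta> (\<pi> j) (xs ! j))"
    using assms \<pi> by (intro finprod_cong') auto
  finally show "(\<Otimes>j\<in>{..<s}. \<beta> (\<pi> j) (xs[i := x] ! j)) =
    \<beta> (\<pi> i) x \<otimes> (\<Otimes>j\<in>{..<s} - {i}. \<beta> (\<pi> j) (xs ! j))" .
next
  show "(\<lambda>\<pi>. \<beta> (\<pi> i) x \<otimes> (\<Otimes>j\<in>{..<s} - {i}. \<beta> (\<pi> j) (xs ! j))) \<in> Q \<rightarrow> carrier R"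
    using assms by (intro Pi_I m_closed finprod_closed) (simp_all add: permutes_lessThan)
qed simp

lemma perm_sum_additive:
  assumes Q: "\<And>\<pi>. \<pi> \<in> Q \<Longrightarrow> \<pi> permutes {..<s}" and s: "length xs = s" "i < s"
    and b: "\<And>i j. i < s \<Longrightarrow> j < s \<Longrightarrow> \<beta> i (xs ! j) \<in> carrier R"
    and x: "\<And>i. i < s \<Longrightarrow> \<beta> i x \<in> carrier R" and y: "\<And>i. i < s \<Longrightarrow> \<beta> i y \<in> carrier R"
    and z: "\<And>i. i < s \<Longrightarrow> \<beta> i z = \<beta> i x \<oplus> \<beta> i y"
  shows "perm_sum R s \<beta> Q (xs[i := z]) = perm_sum R s \<beta> Q (xs[i := x]) \<oplus> perm_sum R s \<beta> Q (xs[i := y])"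
proof -
  have zc: "\<And>i. i < s \<Longrightarrow> \<beta> i z \<in> carrier R" using x y z by simp
  have \<pi>: "\<pi> j < s" if "\<pi> \<in> Q" "j < s" for \<pi> j using Q that permutes_lessThan by blast
  note u = perm_sum_update[OF Q s, of _ \<beta>]
  have "(\<Oplus>\<pi>\<in>Q. \<beta> (\<pi> i) z \<otimes> (\<Otimes>j\<in>{..<s} - {i}. \<beta> (\<pi> j) (xs ! j))) =
    (\<Oplus>\<pi>\<in>Q. \<beta> (\<pi> i) x \<otimes> (\<Otimes>j\<in>{..<s} - {i}. \<beta> (\<pi> j) (xs ! j)) \<oplus>
             \<beta> (\<pi> i) y \<otimes> (\<Otimes>j\<in>{..<s} - {i}. \<beta> (\<pi> j) (xs ! j)))"
    using b x y z \<pi> s by (intro finsum_cong') (auto simp: l_distr intro!: finprod_closed m_closed a_closed)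
  also have "\<dots> = (\<Oplus>\<pi>\<in>Q. \<beta> (\<pi> i) x \<otimes> (\<Otimes>j\<in>{..<s} - {i}. \<beta> (\<pi> j) (xs ! j))) \<oplus>
     (\<Oplus>\<pi>\<in>Q. \<beta> (\<pi> i) y \<otimes> (\<Otimes>j\<in>{..<s} - {i}. \<beta> (\<pi> j) (xs ! j)))"
    using b x y \<pi> s by (intro finsum_addf) (auto intro!: finprod_closed m_closed)
  finally show ?thesis using b x y zc by (simp add: u)
qed

lemma perm_sum_homogeneous:
  assumes Q: "\<And>\<pi>. \<pi> \<in> Q \<Longrightarrow> \<pi> permutes {..<s}" and s: "length xs = s" "i < s"
    and b: "\<And>i j. i < s \<Longrightarrow> j < s \<Longrightarrow> \<beta> i (xs ! j) \<in> carrier R"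
    and x: "\<And>i. i < s \<Longrightarrow> \<beta> i x \<in> carrier R" and c: "c \<in> carrier R"
    and z: "\<And>i. i < s \<Longrightarrow> \<beta> i z = c \<otimes> \<beta> i x"
  shows "perm_sum R s \<beta> Q (xs[i := z]) = c \<otimes> perm_sum R s \<beta> Q (xs[i := x])"
proof -
  have zc: "\<And>i. i < s \<Longrightarrow> \<beta> i z \<in> carrier R" using x c z by simp
  have \<pi>: "\<pi> j < s" if "\<pi> \<in> Q" "j < s" for \<pi> j using Q that permutes_lessThan by blast
  have fin: "finite Q" using Q by (intro finite_subset[OF _ finite_permutations[of "{..<s}"]]) auto
  note u = perm_sum_update[OF Q s, of _ \<beta>]
  have "(\<Oplus>\<pi>\<in>Q. \<beta> (\<pi> i) z \<otimes> (\<Otimes>j\<in>{..<s} - {i}. \<beta> (\<pi> j) (xs ! j))) =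
    (\<Oplus>\<pi>\<in>Q. c \<otimes> (\<beta> (\<pi> i) x \<otimes> (\<Otimes>j\<in>{..<s} - {i}. \<beta> (\<pi> j) (xs ! j))))"
    using b x z c \<pi> s by (intro finsum_cong') (auto simp: m_assoc intro!: finprod_closed m_closed a_closed)
  also have "\<dots> = c \<otimes> (\<Oplus>\<pi>\<in>Q. \<beta> (\<pi> i) x \<otimes> (\<Otimes>j\<in>{..<s} - {i}. \<beta> (\<pi> j) (xs ! j)))"
    using b x c \<pi> s fin by (intro finsum_rdistr[symmetric]) (auto intro!: finprod_closed m_closed)
  finally show ?thesis using b x c zc by (simp add: u)
qed

text \<open>Composition with the transposition of \<open>i\<close> and \<open>j\<close> maps the
  even permutations bijectively onto the odd ones and leaves each product unchanged, because the two
  entries agree. The two sums cancel without any division by two.\<close>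

lemma alt_form_equal_entries:
  assumes ij: "i < j" "j < s" and eq: "xs ! i = xs ! j"
    and b: "\<And>i j. i < s \<Longrightarrow> j < s \<Longrightarrow> \<beta> i (xs ! j) \<in> carrier R"
  shows "alt_form R s \<beta> xs = \<zero>"
proof -
  let ?E = "{\<pi>. \<pi> permutes {..<s} \<and> evenperm \<pi>}" and ?O = "{\<pi>. \<pi> permutes {..<s} \<and> \<not> evenperm \<pi>}"
  define \<tau> where "\<tau> = transpose i j"
  have \<tau>: "\<tau> permutes {..<s}" "\<tau> \<circ> \<tau> = id"
    using ij by (auto simp: \<tau>_def intro: permutes_swap_id)
  have odd: "evenperm (\<pi> \<circ> \<tau>) \<longleftrightarrow> \<not> evenperm \<pi>" if "\<pi> permutes {..<s}" for \<pi>
    using ij evenperm_comp[OF permutes_imp_permutation[OF _ that], of \<tau>]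
    by (simp add: \<tau>_def permutation_swap_id evenperm_swap)
  have img: "?O = (\<lambda>\<pi>. \<pi> \<circ> \<tau>) ` ?E"
  proof (intro equalityI subsetI)
    fix \<pi> assume \<pi>: "\<pi> \<in> ?O"
    then have "\<pi> = (\<pi> \<circ> \<tau>) \<circ> \<tau>" "\<pi> \<circ> \<tau> \<in> ?E"
      using \<tau> odd[of \<pi>] by (auto simp: o_assoc[symmetric] intro: permutes_compose)
    then show "\<pi> \<in> (\<lambda>\<pi>. \<pi> \<circ> \<tau>) ` ?E" by blast
  qed (auto simp: odd \<tau> intro: permutes_compose)
  have inj: "inj_on (\<lambda>\<pi>. \<pi> \<circ> \<tau>) ?E"
    by (rule inj_on_inverseI[of _ "\<lambda>\<pi>. \<pi> \<circ> \<tau>"]) (simp add: o_assoc[symmetric] \<tau>)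
  have "perm_sum R s \<beta> ?O xs = (\<Oplus>\<pi>\<in>?E. \<Otimes>l\<in>{..<s}. \<beta> ((\<pi> \<circ> \<tau>) l) (xs ! l))"
    unfolding perm_sum_def img using b permutes_lessThan \<tau>(1)
    by (subst finsum_reindex[OF _ inj]) (auto intro!: finprod_closed)
  also have "\<dots> = perm_sum R s \<beta> ?E xs"
    unfolding perm_sum_def
  proof (rule finsum_cong')
    fix \<pi> assume "\<pi> \<in> ?E"
    then have p: "\<pi> permutes {..<s}" by simp
    \<comment> \<open>The index \<open>l\<close> is replaced by \<open>\<tau> l\<close>; afterwards
      \<open>xs ! \<tau> l\<close> may be written as \<open>xs ! l\<close>.\<close>
    have "(\<Otimes>l\<in>{..<s}. \<beta> (\<pi> l) (xs ! l)) = (\<Otimes>l\<in>\<tau> ` {..<s}. \<beta> (\<pi> l) (xs ! l))"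
      by (simp add: permutes_image[OF \<tau>(1)])
    also have "\<dots> = (\<Otimes>l\<in>{..<s}. \<beta> (\<pi> (\<tau> l)) (xs ! \<tau> l))"
      using b permutes_lessThan[OF p] permutes_lessThan[OF \<tau>(1)] permutes_inj_on[OF \<tau>(1)]
      by (intro finprod_reindex) auto
    also have "\<dots> = (\<Otimes>l\<in>{..<s}. \<beta> ((\<pi> \<circ> \<tau>) l) (xs ! l))"
      using b permutes_lessThan[OF p] permutes_lessThan[OF \<tau>(1)] eq
      by (intro finprod_cong') (auto simp: \<tau>_def transpose_def)
    finally show "(\<Otimes>l\<in>{..<s}. \<beta> ((\<pi> \<circ> \<tau>) l) (xs ! l)) = (\<Otimes>l\<in>{..<s}. \<beta> (\<pi> l) (xs ! l))" ..
  qed (use b permutes_lessThan in \<open>auto intro!: finprod_closed\<close>)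
  finally show ?thesis using perm_sum_closed[of ?E s \<beta> xs] b
    by (simp add: alt_form_def a_minus_def r_neg)
qed

text \<open>The determinant of the identity matrix: a permutation that moves some \<open>i\<close>
  has the zero factor \<open>\<beta> (\<pi> i) (xs ! i)\<close>, and the identity is even.\<close>

lemma alt_form_dual:
  assumes dual: "\<And>i j. i < s \<Longrightarrow> j < s \<Longrightarrow> \<beta> i (xs ! j) = (if i = j then \<one> else \<zero>)"
  shows "alt_form R s \<beta> xs = \<one>"
proof -
  have t: "(\<Otimes>j\<in>{..<s}. \<beta> (\<pi> j) (xs ! j)) = (if id = \<pi> then \<one> else \<zero>)" if p: "\<pi> permutes {..<s}" for \<pi>
  proof (cases "\<pi> = id")
    case True
    have "(\<Otimes>j\<in>{..<s}. \<beta> (\<pi> j) (xs ! j)) = (\<Otimes>j\<in>{..<s}. \<one>)"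
      using dual True by (intro finprod_cong') auto
    then show ?thesis using True by simp
  next
    case False
    then obtain i where i: "\<pi> i \<noteq> i" by (auto simp: fun_eq_iff)
    then have "i < s" using p by (meson lessThan_iff permutes_not_in)
    then have "{..<s} = insert i ({..<s} - {i})" by auto
    then have "(\<Otimes>j\<in>{..<s}. \<beta> (\<pi> j) (xs ! j)) = (\<Otimes>j\<in>insert i ({..<s} - {i}). \<beta> (\<pi> j) (xs ! j))" by simp
    also have "\<dots> = \<beta> (\<pi> i) (xs ! i) \<otimes> (\<Otimes>j\<in>{..<s} - {i}. \<beta> (\<pi> j) (xs ! j))"
      using dual permutes_lessThan[OF p] \<open>i < s\<close> by (intro finprod_insert) auto
    also have "\<beta> (\<pi> i) (xs ! i) = \<zero>" using dual[OF permutes_lessThan[OF p \<open>i < s\<close>] \<open>i < s\<close>] i by simp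
    also have "\<zero> \<otimes> (\<Otimes>j\<in>{..<s} - {i}. \<beta> (\<pi> j) (xs ! j)) = \<zero>"
      using dual permutes_lessThan[OF p] by (intro l_null finprod_closed) auto
    finally show ?thesis using False by simp
  qed
  have fin: "finite {\<pi>. \<pi> permutes {..<s} \<and> evenperm \<pi>}"
    by (rule finite_subset[OF _ finite_permutations[of "{..<s}"]]) auto
  have "perm_sum R s \<beta> {\<pi>. \<pi> permutes {..<s} \<and> evenperm \<pi>} xs =
     (\<Oplus>\<pi>\<in>{\<pi>. \<pi> permutes {..<s} \<and> evenperm \<pi>}. if id = \<pi> then \<one> else \<zero>)"
    unfolding perm_sum_def by (rule finsum_cong') (auto simp: t)
  also have "\<dots> = \<one>"
    using fin by (intro finsum_singleton) (auto simp: permutes_id evenperm_id)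
  finally have 1: "perm_sum R s \<beta> {\<pi>. \<pi> permutes {..<s} \<and> evenperm \<pi>} xs = \<one>" .
  have "perm_sum R s \<beta> {\<pi>. \<pi> permutes {..<s} \<and> \<not> evenperm \<pi>} xs =
     (\<Oplus>\<pi>\<in>{\<pi>. \<pi> permutes {..<s} \<and> \<not> evenperm \<pi>}. \<zero>)"
    unfolding perm_sum_def by (rule finsum_cong') (auto simp: t evenperm_id)
  then show ?thesis by (simp add: alt_form_def 1 a_minus_def)
qed

end

text \<open>It suffices to work on the free module over the tuples: the form \<open>L\<close> given
  there by the determinant kills \<open>exterior_relations\<close>, hence their span. If the wedge
  were zero, the generator of the tuple \<open>xs\<close> would lie in this span, although
  \<open>L\<close> equals one on it.\<close>

lemma wedge_nonzero:
  assumes M: "module R M" and K: "cring K" "\<one>\<^bsub>K\<^esub> \<noteq> \<zero>\<^bsub>K\<^esub>" and \<phi>: "\<phi> \<in> ring_hom R K"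
    and \<beta>: "\<And>i. i < length xs \<Longrightarrow> linear_along R M K \<phi> (\<beta> i)" and xs: "set xs \<subseteq> carrier M"
    and dual: "\<And>i j. i < length xs \<Longrightarrow> j < length xs \<Longrightarrow> \<beta> i (xs ! j) = (if i = j then \<one>\<^bsub>K\<^esub> else \<zero>\<^bsub>K\<^esub>)"
  shows "wedge R M xs \<noteq> \<zero>\<^bsub>exterior_power R M (length xs)\<^esub>"
proof
  interpret module R M by fact
  interpret K: cring K by fact
  define s where "s = length xs"
  let ?F = "free_module R (tuples s M)" and ?N = "exterior_submodule R M s"
  interpret F: module R ?F by (rule module_free_module[OF R.cring_axioms])
  interpret h: ring_hom_cring R K \<phi> by (rule ring_hom_cringI[OF R.cring_axioms K(1) \<phi>])
  interpret N: abelian_subgroup ?N ?F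
    by (intro abelian_subgroupI3 additive_subgroup.intro
        submodule.axioms(1)[OF submodule_exterior_submodule[OF M]]) unfold_locales
  have b: "\<beta> i x \<in> carrier K" if "i < s" "x \<in> carrier M" for i x
    using linear_alongD(1)[OF \<beta>] that by (simp add: s_def)
  have bt: "\<beta> i (ys ! j) \<in> carrier K" if "ys \<in> tuples s M" "i < s" "j < s" for ys i j
    using that by (intro b) (auto simp: tuples_def)
  define L where "L = lin_ext R K \<phi> (alt_form K s \<beta>)"
  have w: "alt_form K s \<beta> \<in> tuples s M \<rightarrow> carrier K"
    unfolding alt_form_def by (intro Pi_I K.minus_closed K.perm_sum_closed) (auto intro: bt)
  have L: "linear_along R ?F K \<phi> L" unfolding L_def by (rule h.linear_along_lin_ext[OF w])
  have Lg: "L (free_gen R ys) = alt_form K s \<beta> ys" if "ys \<in> tuples s M" for ys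
    unfolding L_def by (rule h.lin_ext_free_gen[OF w that])
  have g: "free_gen R ys \<in> carrier ?F" if "ys \<in> tuples s M" for ys
    using that by (intro free_gen_closed R.cring_axioms)
  have u: "ys[i := x] \<in> tuples s M" if "ys \<in> tuples s M" "x \<in> carrier M" for ys i x
    using that set_update_subset_insert[of ys i x] by (auto simp: tuples_def)
  have len: "length ys = s" if "ys \<in> tuples s M" for ys using that by (simp add: tuples_def)
  let ?E = "{\<pi>. \<pi> permutes {..<s} \<and> evenperm \<pi>}" and ?O = "{\<pi>. \<pi> permutes {..<s} \<and> \<not> evenperm \<pi>}"
  have pc: "perm_sum K s \<beta> ?E ys \<in> carrier K" "perm_sum K s \<beta> ?O ys \<in> carrier K"
    if "ys \<in> tuples s M" for ys
    by (intro K.perm_sum_closed; use bt[OF that] in auto)+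
  have add: "alt_form K s \<beta> (ys[i := x \<oplus>\<^bsub>M\<^esub> y]) =
      alt_form K s \<beta> (ys[i := x]) \<oplus>\<^bsub>K\<^esub> alt_form K s \<beta> (ys[i := y])"
    if t: "ys \<in> tuples s M" "i < s" "x \<in> carrier M" "y \<in> carrier M" for ys i x y
  proof -
    have "perm_sum K s \<beta> Q (ys[i := x \<oplus>\<^bsub>M\<^esub> y]) =
        perm_sum K s \<beta> Q (ys[i := x]) \<oplus>\<^bsub>K\<^esub> perm_sum K s \<beta> Q (ys[i := y])"
      if "Q = ?E \<or> Q = ?O" for Q
      using that t bt[OF t(1)] b
      by (intro K.perm_sum_additive len) (auto simp: linear_alongD(2)[OF \<beta>] s_def)
    then show ?thesis
      using pc[OF u[OF t(1,3), of i]] pc[OF u[OF t(1,4), of i]]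
      by (simp add: alt_form_def a_minus_def K.minus_add K.a_ac)
  qed
  have hom: "alt_form K s \<beta> (ys[i := r \<odot>\<^bsub>M\<^esub> x]) = \<phi> r \<otimes>\<^bsub>K\<^esub> alt_form K s \<beta> (ys[i := x])"
    if t: "ys \<in> tuples s M" "i < s" "r \<in> carrier R" "x \<in> carrier M" for ys i r x
  proof -
    have "perm_sum K s \<beta> Q (ys[i := r \<odot>\<^bsub>M\<^esub> x]) = \<phi> r \<otimes>\<^bsub>K\<^esub> perm_sum K s \<beta> Q (ys[i := x])"
      if "Q = ?E \<or> Q = ?O" for Q
      using that t bt[OF t(1)] b
      by (intro K.perm_sum_homogeneous len) (auto simp: linear_alongD(3)[OF \<beta>] s_def)
    then show ?thesis
      using pc[OF u[OF t(1,4), of i]] t(3)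
      by (simp add: alt_form_def a_minus_def K.r_distr K.r_minus)
  qed
  have rel: "f \<in> carrier ?F \<and> L f = \<zero>\<^bsub>K\<^esub>" if f: "f \<in> exterior_relations R M s" for f
    using f unfolding exterior_relations_def Let_def
  proof (elim UnE CollectE exE conjE)
    fix ys i x y
    assume t: "ys \<in> tuples s M" "i < s" "x \<in> carrier M" "y \<in> carrier M"
      and f: "f = free_gen R (ys[i := x \<oplus>\<^bsub>M\<^esub> y]) \<ominus>\<^bsub>?F\<^esub>
        (free_gen R (ys[i := x]) \<oplus>\<^bsub>?F\<^esub> free_gen R (ys[i := y]))"
    have c: "ys[i := x \<oplus>\<^bsub>M\<^esub> y] \<in> tuples s M" "ys[i := x] \<in> tuples s M" "ys[i := y] \<in> tuples s M"
      using t u by auto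
    have "L f = alt_form K s \<beta> (ys[i := x \<oplus>\<^bsub>M\<^esub> y]) \<ominus>\<^bsub>K\<^esub>
        (alt_form K s \<beta> (ys[i := x]) \<oplus>\<^bsub>K\<^esub> alt_form K s \<beta> (ys[i := y]))"
      unfolding f using g c
      by (simp add: linear_along_minus[OF F.module_axioms K(1) L] linear_alongD(2)[OF L] Lg)
    with w c show ?thesis
      by (auto simp: f add[OF t] a_minus_def K.r_neg Pi_iff intro!: F.M.minus_closed F.M.a_closed g)
  next
    fix ys i r x
    assume t: "ys \<in> tuples s M" "i < s" "r \<in> carrier R" "x \<in> carrier M"
      and f: "f = free_gen R (ys[i := r \<odot>\<^bsub>M\<^esub> x]) \<ominus>\<^bsub>?F\<^esub> (r \<odot>\<^bsub>?F\<^esub> free_gen R (ys[i := x]))"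
    have c: "ys[i := r \<odot>\<^bsub>M\<^esub> x] \<in> tuples s M" "ys[i := x] \<in> tuples s M"
      using t u by auto
    have "L f = alt_form K s \<beta> (ys[i := r \<odot>\<^bsub>M\<^esub> x]) \<ominus>\<^bsub>K\<^esub> (\<phi> r \<otimes>\<^bsub>K\<^esub> alt_form K s \<beta> (ys[i := x]))"
      unfolding f using g c t(3)
      by (simp add: linear_along_minus[OF F.module_axioms K(1) L] linear_alongD(3)[OF L] Lg)
    with w c t(3) show ?thesis
      by (auto simp: f hom[OF t] a_minus_def K.r_neg Pi_iff intro!: F.M.minus_closed F.smult_closed g)
  next
    fix ys i j
    assume t: "ys \<in> tuples s M" "i < j" "j < s" "ys ! i = ys ! j" and f: "f = free_gen R ys"
    then show ?thesis
      using g[OF t(1)] K.alt_form_equal_entries[OF t(2-4), of \<beta>] bt[OF t(1)] by (simp add: Lg)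
  qed
  assume z: "wedge R M xs = \<zero>\<^bsub>exterior_power R M (length xs)\<^esub>"
  have xt: "xs \<in> tuples s M" using xs by (simp add: tuples_def s_def)
  \<comment> \<open>The zero of the quotient is the coset \<open>?N\<close> itself.\<close>
  have "?N +>\<^bsub>?F\<^esub> free_gen R xs = ?N"
    using z by (simp add: wedge_def exterior_power_def quotient_module_def s_def)
  then have "free_gen R xs \<in> ?N" using N.a_rcos_self[OF g[OF xt]] by simp
  then have "L (free_gen R xs) = \<zero>\<^bsub>K\<^esub>"
    unfolding exterior_submodule_def
    by (rule linear_along_span[OF F.module_axioms K(1) \<phi> L, rotated 2]) (use rel in auto)
  moreover have "alt_form K s \<beta> xs = \<one>\<^bsub>K\<^esub>" by (rule K.alt_form_dual) (simp add: dual s_def)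
  ultimately show False using K(2) by (simp add: Lg[OF xt])
qed

section \<open>Partial derivatives carried over to the differentials of the algebra\<close>

theorem proposition1p6:
  fixes k :: "('k, 'm) ring_scheme"
    and A :: "('k, 'a, 'n) module_scheme"
    and s :: nat
    and \<iota> :: "(nat multiset \<Rightarrow> 'k) \<Rightarrow> 'a"
  assumes "field k"
    and char_zero: "\<And>n :: nat. n > 0 \<Longrightarrow> [n] \<cdot>\<^bsub>k\<^esub> \<one>\<^bsub>k\<^esub> \<noteq> \<zero>\<^bsub>k\<^esub>"
    and "algebra k A"
    and "s \<ge> 1"
    and "\<iota> \<in> algebra_hom k (mpoly_algebra k {1..s}) A"
    and "inj_on \<iota> (carrier (mpoly_algebra k {1..s}))"
  shows "wedge A (kaehler k A) (map (\<lambda>i. kaehler_d k A (\<iota> (ring.indexed_var k i))) [1..<Suc s])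
           \<in> carrier (exterior_power A (kaehler k A) s) - {\<zero>\<^bsub>exterior_power A (kaehler k A) s\<^esub>}"
proof -
  interpret k: field k by fact
  interpret alg: algebra k A by fact
  define I where "I = {1..s}"
  note hom = assms(5)[folded I_def] and inj = assms(6)[folded I_def]
  let ?M = "mpoly_algebra k I"
  have M: "\<one>\<^bsub>?M\<^esub> = k.indexed_const \<one>\<^bsub>k\<^esub>" "\<zero>\<^bsub>?M\<^esub> = k.indexed_const \<zero>\<^bsub>k\<^esub>"
    "\<And>P Q. P \<oplus>\<^bsub>?M\<^esub> Q = k.indexed_padd P Q"
    by (simp_all add: mpoly_algebra_def)
  have \<iota>: "\<iota> \<in> ring_hom ?M A" and \<iota>_smult: "\<And>c P. c \<in> carrier k \<Longrightarrow> P \<in> carrier ?M \<Longrightarrow> \<iota> (c \<odot>\<^bsub>?M\<^esub> P) = c \<odot>\<^bsub>A\<^esub> \<iota> P"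
    using hom by (auto simp: algebra_hom_def)
  have const: "k.indexed_const c \<in> carrier ?M" if "c \<in> carrier k" for c using that by (rule k.mpoly_intros)
  have const_eq: "c = d" if "(k.indexed_const c :: nat multiset \<Rightarrow> 'k) = k.indexed_const d" for c d
    using fun_cong[OF that, of "{#}"] by (simp add: k.indexed_const_def)
  have padd_zero: "k.indexed_padd (k.indexed_const \<zero>\<^bsub>k\<^esub>) (k.indexed_const \<zero>\<^bsub>k\<^esub>) = (k.indexed_const \<zero>\<^bsub>k\<^esub> :: nat multiset \<Rightarrow> 'k)"
    by (simp add: k.indexed_padd_const)
  \<comment> \<open>Obtained from \<open>0 + 0 = 0\<close> alone, as the convolution algebra has not
    been established as a ring.\<close>
  have \<iota>_zero: "\<iota> (k.indexed_const \<zero>\<^bsub>k\<^esub>) = \<zero>\<^bsub>A\<^esub>"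
    using ring_hom_add[OF \<iota> const[OF k.zero_closed] const[OF k.zero_closed]]
      ring_hom_closed[OF \<iota> const[OF k.zero_closed]]
    by (intro cring.add_self_eq[OF alg.M_cring]) (simp_all add: M padd_zero)
  define S where "S = \<iota> ` (carrier ?M - {k.indexed_const \<zero>\<^bsub>k\<^esub>})"
  have "\<zero>\<^bsub>A\<^esub> \<notin> S"
    using inj_onD[OF inj, of _ "k.indexed_const \<zero>\<^bsub>k\<^esub>"] const[OF k.zero_closed]
    by (auto simp: S_def \<iota>_zero[symmetric])
  moreover have "\<one>\<^bsub>A\<^esub> \<in> S"
    using ring_hom_one[OF \<iota>] const[OF k.one_closed] const_eq[of "\<one>\<^bsub>k\<^esub>" "\<zero>\<^bsub>k\<^esub>"]
    unfolding S_def M(1) by (intro image_eqI[of _ _ "k.indexed_const \<one>\<^bsub>k\<^esub>"]) auto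
  moreover have "a \<otimes>\<^bsub>A\<^esub> b \<in> S" if ab: "a \<in> S" "b \<in> S" for a b
  proof -
    obtain P Q where PQ: "P \<in> carrier ?M" "Q \<in> carrier ?M" "a = \<iota> P" "b = \<iota> Q"
      "P \<noteq> k.indexed_const \<zero>\<^bsub>k\<^esub>" "Q \<noteq> k.indexed_const \<zero>\<^bsub>k\<^esub>" using ab by (auto simp: S_def)
    then have "a \<otimes>\<^bsub>A\<^esub> b = \<iota> (P \<otimes>\<^bsub>?M\<^esub> Q)" by (simp add: ring_hom_mult[OF \<iota>])
    then show ?thesis
      using k.mpoly_mult_closed[OF PQ(1,2)] k.mpoly_mult_nonzero[OF PQ(1,2,5,6)] by (simp add: S_def)
  qed
  moreover have "S \<subseteq> carrier A" using ring_hom_closed[OF \<iota>] by (auto simp: S_def)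
  ultimately obtain K :: "('a set \<times> 'a set) set ring" and \<phi>
    where "field K" and \<phi>: "\<phi> \<in> ring_hom A K" and \<phi>S: "\<And>a. a \<in> S \<Longrightarrow> \<phi> a \<noteq> \<zero>\<^bsub>K\<^esub>"
    using exists_field_hom[OF alg.M_cring] by metis
  interpret K: field K by fact
  define \<psi> where "\<psi> P = \<phi> (\<iota> P)" for P
  have \<psi>: "\<psi> P \<in> carrier K" "Q \<in> carrier ?M \<Longrightarrow> \<psi> (k.indexed_padd P Q) = \<psi> P \<oplus>\<^bsub>K\<^esub> \<psi> Q"
    "Q \<in> carrier ?M \<Longrightarrow> \<psi> (P \<otimes>\<^bsub>?M\<^esub> Q) = \<psi> P \<otimes>\<^bsub>K\<^esub> \<psi> Q"
    if "P \<in> carrier ?M" for P Q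
    using that ring_hom_closed[OF \<iota>] ring_hom_add[OF \<iota>] ring_hom_mult[OF \<iota>]
      ring_hom_closed[OF \<phi>] ring_hom_add[OF \<phi>] ring_hom_mult[OF \<phi>]
    by (simp_all add: \<psi>_def M)
  have \<psi>1: "\<psi> (k.indexed_const \<one>\<^bsub>k\<^esub>) = \<one>\<^bsub>K\<^esub>"
    using ring_hom_one[OF \<iota>] ring_hom_one[OF \<phi>] by (simp add: \<psi>_def M)
  have \<psi>0: "\<psi> (k.indexed_const \<zero>\<^bsub>k\<^esub>) = \<zero>\<^bsub>K\<^esub>"
    using \<psi>(1)[OF const[OF k.zero_closed]] \<psi>(2)[OF const[OF k.zero_closed] const[OF k.zero_closed]]
    by (intro K.add_self_eq) (simp_all add: padd_zero)
  \<comment> \<open>A nonzero polynomial is mapped into \<open>S\<close> by \<open>\<iota>\<close>,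
    and \<open>\<phi>\<close> does not vanish on \<open>S\<close>.\<close>
  have \<psi>_inj: "P = k.indexed_const \<zero>\<^bsub>k\<^esub>" if "P \<in> carrier ?M" "\<psi> P = \<zero>\<^bsub>K\<^esub>" for P
    using \<phi>S[of "\<iota> P"] that by (auto simp: S_def \<psi>_def)
  have \<psi>_const_add: "\<psi> (k.indexed_const (c \<oplus>\<^bsub>k\<^esub> d)) = \<psi> (k.indexed_const c) \<oplus>\<^bsub>K\<^esub> \<psi> (k.indexed_const d)"
    if "c \<in> carrier k" "d \<in> carrier k" for c d
    using \<psi>(2)[OF const[OF that(1)] const[OF that(2)]] by (simp add: k.indexed_padd_const)
  \<comment> \<open>\<open>K\<close> inherits characteristic zero from \<open>k\<close>, which
    embeds through the constant polynomials.\<close>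
  have charK: "[n] \<cdot>\<^bsub>K\<^esub> \<one>\<^bsub>K\<^esub> \<noteq> \<zero>\<^bsub>K\<^esub>" if n: "n > 0" for n :: nat
  proof
    assume z: "[n] \<cdot>\<^bsub>K\<^esub> \<one>\<^bsub>K\<^esub> = \<zero>\<^bsub>K\<^esub>"
    have "\<psi> (k.indexed_const ([n] \<cdot>\<^bsub>k\<^esub> \<one>\<^bsub>k\<^esub>)) = [n] \<cdot>\<^bsub>K\<^esub> \<one>\<^bsub>K\<^esub>" for n :: nat
      by (induction n) (simp_all add: \<psi>0 \<psi>1 \<psi>_const_add)
    then have "\<psi> (k.indexed_const ([n] \<cdot>\<^bsub>k\<^esub> \<one>\<^bsub>k\<^esub>)) = \<zero>\<^bsub>K\<^esub>" using z by simp
    then have "k.indexed_const ([n] \<cdot>\<^bsub>k\<^esub> \<one>\<^bsub>k\<^esub>) = (k.indexed_const \<zero>\<^bsub>k\<^esub> :: nat multiset \<Rightarrow> 'k)"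
      by (intro \<psi>_inj const) simp_all
    then show False using const_eq char_zero[OF n] by blast
  qed
  interpret E: cring "dual_ring K" by (rule K.cring_dual_ring)
  \<comment> \<open>Negatives in \<open>G i\<close> will be formed as products with the image of the
    constant \<open>-1\<close>.\<close>
  have neg_one: "\<psi> (k.indexed_const (\<ominus>\<^bsub>k\<^esub> \<one>\<^bsub>k\<^esub>)) = \<ominus>\<^bsub>K\<^esub> \<one>\<^bsub>K\<^esub>"
    using \<psi>_const_add[of "\<ominus>\<^bsub>k\<^esub> \<one>\<^bsub>k\<^esub>" "\<one>\<^bsub>k\<^esub>"] \<psi>(1)[OF const, of "\<ominus>\<^bsub>k\<^esub> \<one>\<^bsub>k\<^esub>"]
    by (intro K.minus_equality[symmetric]) (simp_all add: k.l_neg \<psi>0 \<psi>1)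
  \<comment> \<open>The graph of \<open>\<partial>/\<partial>t\<^sub>i\<close> on the image of the
    polynomials in \<open>K\<close>. It is single-valued because \<open>\<psi>\<close> is
    injective.\<close>
  define G where "G i = (\<lambda>P. (\<psi> P, \<psi> (k.mpoly_pderiv i P))) ` carrier ?M" for i
  have G_const: "(\<psi> (k.indexed_const c), \<zero>\<^bsub>K\<^esub>) \<in> G i" if "c \<in> carrier k" for c i
    unfolding G_def using const[OF that] \<psi>0
    by (intro image_eqI[of _ _ "k.indexed_const c"]) (simp_all add: k.mpoly_pderiv_const)
  have G: "graph_like K (G i)" for i
    unfolding graph_like_def
  proof
    have Gc: "G i \<subseteq> carrier (dual_ring K)"
      by (auto simp: G_def intro!: \<psi>(1) k.mpoly_pderiv_closed)
    have Gm: "x \<otimes>\<^bsub>dual_ring K\<^esub> y \<in> G i" if xy: "x \<in> G i" "y \<in> G i" for x y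
    proof -
      obtain P Q where PQ: "P \<in> carrier ?M" "Q \<in> carrier ?M"
        "x = (\<psi> P, \<psi> (k.mpoly_pderiv i P))" "y = (\<psi> Q, \<psi> (k.mpoly_pderiv i Q))"
        using xy by (auto simp: G_def)
      note c = PQ(1,2) k.mpoly_pderiv_closed[OF PQ(1), of i] k.mpoly_pderiv_closed[OF PQ(2), of i]
      have "x \<otimes>\<^bsub>dual_ring K\<^esub> y = (\<psi> (P \<otimes>\<^bsub>?M\<^esub> Q), \<psi> (k.mpoly_pderiv i (P \<otimes>\<^bsub>?M\<^esub> Q)))"
        using c by (simp add: PQ(3,4) k.mpoly_pderiv_mult \<psi> k.mpoly_mult_closed)
      then show ?thesis unfolding G_def using k.mpoly_mult_closed[OF PQ(1,2)] by blast
    qed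
    show "subring (G i) (dual_ring K)"
    proof (rule E.subringI[OF Gc])
      show "\<one>\<^bsub>dual_ring K\<^esub> \<in> G i" using G_const[of "\<one>\<^bsub>k\<^esub>"] by (simp add: \<psi>1)
    next
      fix x assume x: "x \<in> G i"
      have "(\<ominus>\<^bsub>K\<^esub> \<one>\<^bsub>K\<^esub>, \<zero>\<^bsub>K\<^esub>) \<in> G i" using G_const[of "\<ominus>\<^bsub>k\<^esub> \<one>\<^bsub>k\<^esub>"] by (simp add: neg_one)
      then have "(\<ominus>\<^bsub>K\<^esub> \<one>\<^bsub>K\<^esub>, \<zero>\<^bsub>K\<^esub>) \<otimes>\<^bsub>dual_ring K\<^esub> x \<in> G i" using x by (rule Gm)
      moreover have "x \<in> carrier (dual_ring K)" using x Gc by blast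
      ultimately show "\<ominus>\<^bsub>dual_ring K\<^esub> x \<in> G i"
        by (auto simp: K.dual_ring_a_inv K.l_minus)
    next
      fix x y assume "x \<in> G i" "y \<in> G i"
      then show "x \<otimes>\<^bsub>dual_ring K\<^esub> y \<in> G i" by (rule Gm)
    next
      fix x y assume xy: "x \<in> G i" "y \<in> G i"
      then obtain P Q where PQ: "P \<in> carrier ?M" "Q \<in> carrier ?M"
        "x = (\<psi> P, \<psi> (k.mpoly_pderiv i P))" "y = (\<psi> Q, \<psi> (k.mpoly_pderiv i Q))"
        by (auto simp: G_def)
      have "x \<oplus>\<^bsub>dual_ring K\<^esub> y = (\<psi> (k.indexed_padd P Q), \<psi> (k.mpoly_pderiv i (k.indexed_padd P Q)))"
        using PQ k.mpoly_closed[OF PQ(1)] k.mpoly_closed[OF PQ(2)]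
        by (simp add: k.mpoly_pderiv_padd \<psi> k.mpoly_pderiv_closed)
      then show "x \<oplus>\<^bsub>dual_ring K\<^esub> y \<in> G i" unfolding G_def using k.mpoly_intros(2)[OF PQ(1,2)] by blast
    qed
    show "\<forall>b. (\<zero>\<^bsub>K\<^esub>, b) \<in> G i \<longrightarrow> b = \<zero>\<^bsub>K\<^esub>"
    proof (intro allI impI)
      fix b assume "(\<zero>\<^bsub>K\<^esub>, b) \<in> G i"
      then obtain P where P: "P \<in> carrier ?M" "\<psi> P = \<zero>\<^bsub>K\<^esub>" "b = \<psi> (k.mpoly_pderiv i P)"
        unfolding G_def by (elim imageE) simp
      from \<psi>_inj[OF P(1,2)] P(3) show "b = \<zero>\<^bsub>K\<^esub>" by (simp add: k.mpoly_pderiv_const \<psi>0)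
    qed
  qed
  have "\<exists>\<beta>. linear_along A (kaehler k A) K \<phi> \<beta> \<and>
      (\<forall>P\<in>carrier ?M. \<beta> (kaehler_d k A (\<iota> P)) = \<psi> (k.mpoly_pderiv i P))" for i
  proof -
    obtain D where D: "derivation_along K K id D" "\<And>a b. (a, b) \<in> G i \<Longrightarrow> D a = b"
      using K.extend_derivation[OF charK G] by blast
    have DP: "D (\<psi> P) = \<psi> (k.mpoly_pderiv i P)" if "P \<in> carrier ?M" for P
      using that by (intro D(2)) (simp add: G_def)
    \<comment> \<open>Here linearity over \<open>k\<close> is regained: \<open>c\<close> acts on
      \<open>A\<close> as the image of a constant polynomial, whose partial derivatives
      vanish.\<close>
    have "(D \<circ> \<phi>) (c \<odot>\<^bsub>A\<^esub> \<one>\<^bsub>A\<^esub>) = \<zero>\<^bsub>K\<^esub>" if c: "c \<in> carrier k" for c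
    proof -
      have "c \<odot>\<^bsub>?M\<^esub> \<one>\<^bsub>?M\<^esub> = k.indexed_const c"
        using c by (auto simp: mpoly_algebra_def k.indexed_const_def)
      then have "c \<odot>\<^bsub>A\<^esub> \<one>\<^bsub>A\<^esub> = \<iota> (k.indexed_const c)"
        using \<iota>_smult[OF c const[OF k.one_closed]] ring_hom_one[OF \<iota>] by (simp add: M)
      then have "(D \<circ> \<phi>) (c \<odot>\<^bsub>A\<^esub> \<one>\<^bsub>A\<^esub>) = D (\<psi> (k.indexed_const c))" by (simp add: \<psi>_def)
      then show ?thesis using D(2)[OF G_const[OF c]] by simp
    qed
    then obtain \<beta> where "linear_along A (kaehler k A) K \<phi> \<beta>"
        "\<And>a. a \<in> carrier A \<Longrightarrow> \<beta> (kaehler_d k A a) = (D \<circ> \<phi>) a"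
      using derivation_kaehler[OF assms(3) K.cring_axioms \<phi> derivation_along_comp[OF D(1) \<phi>]] by blast
    then show ?thesis using DP ring_hom_closed[OF \<iota>] by (auto simp: \<psi>_def)
  qed
  then obtain \<beta> where \<beta>: "\<And>i. linear_along A (kaehler k A) K \<phi> (\<beta> i)"
      "\<And>i P. P \<in> carrier ?M \<Longrightarrow> \<beta> i (kaehler_d k A (\<iota> P)) = \<psi> (k.mpoly_pderiv i P)"
    by metis
  let ?xs = "map (\<lambda>i. kaehler_d k A (\<iota> (k.indexed_var i))) [1..<Suc s]"
  have var: "k.indexed_var i \<in> carrier ?M" if "i \<in> I" for i
    using that by (rule k.indexed_var_closed)
  have xs: "set ?xs \<subseteq> carrier (kaehler k A)"
    using var ring_hom_closed[OF \<iota>] by (auto simp: I_def intro!: kaehler_d_closed[OF assms(3)])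
  have "wedge A (kaehler k A) ?xs \<noteq> \<zero>\<^bsub>exterior_power A (kaehler k A) (length ?xs)\<^esub>"
  \<comment> \<open>List positions start at zero and variables at one, so position \<open>j\<close>
    holds the differential of \<open>t\<^sub>j\<^sub>+\<^sub>1\<close> and is paired with
    \<open>\<beta> (Suc j)\<close>.\<close>
  proof (rule wedge_nonzero[OF kaehler_module[OF assms(3)] K.cring_axioms _ \<phi> _ xs, where \<beta> = "\<lambda>i. \<beta> (Suc i)"])
    fix i j assume "i < length ?xs" "j < length ?xs"
    then show "\<beta> (Suc i) (?xs ! j) = (if i = j then \<one>\<^bsub>K\<^esub> else \<zero>\<^bsub>K\<^esub>)"
      using \<beta>(2)[OF var, of "Suc j" "Suc i"] by (simp add: I_def k.mpoly_pderiv_var \<psi>0 \<psi>1 del: upt_Suc)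
  qed (use \<beta> in auto)
  moreover have "wedge A (kaehler k A) ?xs \<in> carrier (exterior_power A (kaehler k A) (length ?xs))"
    by (rule wedge_closed[OF kaehler_module[OF assms(3)] xs])
  ultimately show ?thesis by (simp del: upt_Suc)
qed

end
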